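(* For $j,k\in\mathbb{Z}$ let $\tilde A_{jk}\in\mathbb{C}^{G\times L}$ be the matrix with entries $$(\tilde A_{jk})_{gl}:=(2T)\,w_{jk,l}(\alpha_g^xh_l,\alpha_g^yh_l),\qquad g=1,\dots,G,\ l=1,\dots,L.$$ Then for every $\phi=(\phi_l)_{l=1}^L\in\prod_{l=1}^LL_2(c_l\Omega_T)$, with coefficient vectors $\phi_{jk}=(\phi_{jk,l})_{l=1}^L\in\mathbb{C}^L$, $\phi_{jk,l}:=\langle\phi_l,w_{jk,l}\rangle_{L_2(c_l\Omega_T)}$, there holds $$(\tilde A\phi)(x,y)=\sum_{j,k\in\mathbb{Z}}(\tilde A_{jk}\phi_{jk})\,w_{jk}(x,y)$$ in $L_2(\Omega_T)^G$.
   Context: Pure laser guide star setting. Let $\Omega_A\subset\mathbb{R}^2$ be the telescope aperture, $\alpha_g=(\alpha_g^x,\alpha_g^y)\in\mathbb{R}^2$, $g=1,\dots,G$, the guide star directions, $0\le h_1<\dots<h_L$ the layer heights, $h_{\mathrm{LGS}}>h_L$ the guide star height, and $c_l:=1-h_l/h_{\mathrm{LGS}}\in(0,1]$. Let $\Omega_T:=[-T,T]^2$ with $T>0$ so large that $\Omega_A+\alpha_gh_l\subset c_l\Omega_T$ for all $g,l$. The periodic atmospheric tomography operator is $$\tilde A:\prod_{l=1}^LL_2(c_l\Omega_T)\to L_2(\Omega_T)^G,\qquad(\tilde A\phi)_g(r):=\sum_{l=1}^L\phi_l(c_lr+\alpha_gh_l),\quad g=1,\dots,G,$$ where functions in $L_2(c_l\Omega_T)$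 are understood as extended periodically to $\mathbb{R}^2$ (with period $2c_lT$ in each variable). All $L_2$ spaces are complex with $\langle f,h\rangle=\int f\overline h$. For $j,k\in\mathbb{Z}$, $w_{jk}(x,y):=\frac1{2T}e^{ij\omega x}e^{ik\omega y}$ with $\omega:=\pi/T$, which form an orthonormal basis of $L_2(\Omega_T)$, and $w_{jk,l}(x,y):=c_l^{-1}w_{jk}((x,y)/c_l)$, which form an orthonormal basis of $L_2(c_l\Omega_T)$. *)

theory Defs
  imports "HOL-Analysis.Analysis"
begin

text \<open>
  Square-integrable functions are represented by functions on the whole space of which only the
  values on \<open>S\<close>, up to null sets, matter. For \<^typ>\<open>complex ^ 'g\<close>-valued functions, \<open>L2 S\<close> is the
  Hilbert product of one copy of the scalar space for each index in \<^typ>\<open>'g\<close>, because the norm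
  of \<^typ>\<open>complex ^ 'g\<close> is Euclidean.
\<close>

definition L2 :: "'a::euclidean_space set \<Rightarrow> ('a \<Rightarrow> 'b::euclidean_space) set" where
  "L2 S = {f. f \<in> borel_measurable (lebesgue_on S) \<and>
              integrable (lebesgue_on S) (\<lambda>x. (norm (f x))\<^sup>2)}"

definition L2_norm :: "'a::euclidean_space set \<Rightarrow> ('a \<Rightarrow> 'b::euclidean_space) \<Rightarrow> real" where
  "L2_norm S f = sqrt (LINT x|lebesgue_on S. (norm (f x))\<^sup>2)"

definition L2_inner :: "'a::euclidean_space set \<Rightarrow> ('a \<Rightarrow> complex) \<Rightarrow> ('a \<Rightarrow> complex) \<Rightarrow> complex" where
  "L2_inner S f h = (LINT x|lebesgue_on S. f x * cnj (h x))"

text \<open>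
  Unconditional summation in \<open>L2 S\<close>, along the same filter as \<^const>\<open>has_sum\<close>. Membership in \<open>L2 S\<close>
  is required explicitly, since the integral in \<^const>\<open>L2_norm\<close> is 0 for non-integrable functions.
\<close>

definition L2_has_sum ::
  "'a::euclidean_space set \<Rightarrow> ('i \<Rightarrow> 'a \<Rightarrow> 'b::euclidean_space) \<Rightarrow> ('a \<Rightarrow> 'b) \<Rightarrow> 'i set \<Rightarrow> bool" where
  "L2_has_sum S f s I \<longleftrightarrow>
     (\<forall>i\<in>I. f i \<in> L2 S) \<and> s \<in> L2 S \<and>
     ((\<lambda>F. L2_norm S (\<lambda>x. s x - (\<Sum>i\<in>F. f i x))) \<longlongrightarrow> 0) (finite_subsets_at_top I)"

definition Omega :: "real \<Rightarrow> (real \<times> real) set" where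
  "Omega T = {-T..T} \<times> {-T..T}"

text \<open>
  Periodic extension, with period \<open>2 * P\<close> in each variable, of a function on \<open>Omega P\<close>. Each point is
  reduced to the half-open square \<open>[-P, P)\<times>[-P, P)\<close>; the values on the remaining two edges are
  discarded, which changes the function on a null set only.
\<close>

definition periodic_ext :: "real \<Rightarrow> (real \<times> real \<Rightarrow> 'b) \<Rightarrow> real \<times> real \<Rightarrow> 'b" where
  "periodic_ext P f = (\<lambda>(x, y).
     f (x - 2 * P * of_int \<lfloor>(x + P) / (2 * P)\<rfloor>, y - 2 * P * of_int \<lfloor>(y + P) / (2 * P)\<rfloor>))"

definition cone :: "('l \<Rightarrow> real) \<Rightarrow> real \<Rightarrow> 'l \<Rightarrow> real" where
  "cone h hLGS l = 1 - h l / hLGS"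

definition layer_dom :: "('l \<Rightarrow> real) \<Rightarrow> real \<Rightarrow> real \<Rightarrow> 'l \<Rightarrow> (real \<times> real) set" where
  "layer_dom h hLGS T l = (\<lambda>r. cone h hLGS l *\<^sub>R r) ` Omega T"

definition tomography ::
  "('g::finite \<Rightarrow> real \<times> real) \<Rightarrow> ('l::finite \<Rightarrow> real) \<Rightarrow> real \<Rightarrow> real \<Rightarrow>
   ('l \<Rightarrow> real \<times> real \<Rightarrow> complex) \<Rightarrow> real \<times> real \<Rightarrow> complex ^ 'g" where
  "tomography \<alpha> h hLGS T \<phi> = (\<lambda>r. \<chi> g. \<Sum>l\<in>UNIV.
     periodic_ext (cone h hLGS l * T) (\<phi> l) (cone h hLGS l *\<^sub>R r + h l *\<^sub>R \<alpha> g))"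

definition w :: "real \<Rightarrow> int \<Rightarrow> int \<Rightarrow> real \<times> real \<Rightarrow> complex" where
  "w T j k = (\<lambda>(x, y). let \<omega> = pi / T in
     of_real (1 / (2 * T)) * exp (\<i> * of_real (of_int j * \<omega> * x)) * exp (\<i> * of_real (of_int k * \<omega> * y)))"

definition w_layer ::
  "('l \<Rightarrow> real) \<Rightarrow> real \<Rightarrow> real \<Rightarrow> int \<Rightarrow> int \<Rightarrow> 'l \<Rightarrow> real \<times> real \<Rightarrow> complex" where
  "w_layer h hLGS T j k l = (\<lambda>r.
     of_real (inverse (cone h hLGS l)) * w T j k (r /\<^sub>R cone h hLGS l))"

definition tomography_matrix ::
  "('g::finite \<Rightarrow> real \<times> real) \<Rightarrow> ('l::finite \<Rightarrow> real) \<Rightarrow> real \<Rightarrow> real \<Rightarrow> int \<Rightarrow> int \<Rightarrow>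
   complex ^ 'l ^ 'g" where
  "tomography_matrix \<alpha> h hLGS T j k =
     (\<chi> g l. of_real (2 * T) * w_layer h hLGS T j k l (fst (\<alpha> g) * h l, snd (\<alpha> g) * h l))"

definition layer_coeffs ::
  "('l::finite \<Rightarrow> real) \<Rightarrow> real \<Rightarrow> real \<Rightarrow> ('l \<Rightarrow> real \<times> real \<Rightarrow> complex) \<Rightarrow> int \<Rightarrow> int \<Rightarrow>
   complex ^ 'l" where
  "layer_coeffs h hLGS T \<phi> j k =
     (\<chi> l. L2_inner (layer_dom h hLGS T l) (\<phi> l) (w_layer h hLGS T j k l))"

end

theory Submission
  imports Defs
begin

text \<open>
  Each component of the tomography operator is a finite sum over the layers of maps of the form
  \<open>f \<mapsto> f\<^sub>p\<^sub>e\<^sub>r (c r + a)\<close>. After rescaling the layer to the square \<open>Omega T\<close>, such a map becomes a shift by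
  \<open>a / c\<close> modulo the period lattice. A shift is an isometry, and the Fourier functions \<open>w T j k\<close> are
  eigenfunctions of it, because they are multiples of characters that are trivial on the lattice. Applying the shift to the
  convergent Fourier series of the rescaled layer gives the series with every coefficient multiplied by the eigenvalue
  \<open>2 * T * w T j k (a / c)\<close>, which up to the factor \<open>1 / c\<close> is an entry of the matrix. Summation over layers
  and over the components of the vector is then formal.

  Two facts carry the argument. The first is that the shift modulo the lattice preserves Lebesgue
  measure (\<open>wrap_shift_measurable\<close>): the square is cut into countably many pieces, each of
  which is moved by an ordinary translation. The same fact yields the
  orthogonality of the characters, since the integral of a nontrivial one is multiplied by a number other than 1
  when it is shifted (\<open>integral_w\<close>).

  The second is completeness of the Fourier system (\<open>L2_has_sum_fourier\<close>). For any orthonormal system,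
  the functions that equal their expansion form a closed subspace, by Bessel's inequality
  (\<open>expands_approx\<close>). Here this subspace contains the trigonometric polynomials, hence by
  Stone--Weierstrass all continuous functions on the torus; these approximate indicators of open subsets
  of the open square, which by outer regularity approximate indicators of measurable sets, and simple
  functions are dense.
\<close>

section \<open>Square-integrable functions\<close>

text \<open>
  The parallelogram law yields a substitute for the triangle inequality in terms of squared norms.
  Squared \<open>L2\<close> norms are plain integrals, and in every limit argument below the factor 2 is harmless.
\<close>

lemma norm_add_squared_le:
  fixes a b :: "'a::real_inner"
  shows "(norm (a + b))\<^sup>2 \<le> 2 * (norm a)\<^sup>2 + 2 * (norm b)\<^sup>2"
proof -
  have "(norm (a + b))\<^sup>2 + (norm (a - b))\<^sup>2 = 2 * (norm a)\<^sup>2 + 2 * (norm b)\<^sup>2"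
    by (simp add: power2_norm_eq_inner algebra_simps inner_commute)
  then show ?thesis
    by (smt (verit) zero_le_power2)
qed

lemma L2_measurable: "f \<in> L2 S \<Longrightarrow> f \<in> borel_measurable (lebesgue_on S)"
  and L2_integrable: "f \<in> L2 S \<Longrightarrow> integrable (lebesgue_on S) (\<lambda>x. (norm (f x))\<^sup>2)"
  by (auto simp: L2_def)

lemma L2_norm_squared: "(L2_norm S f)\<^sup>2 = (LINT x|lebesgue_on S. (norm (f x))\<^sup>2)"
  by (simp add: L2_norm_def)

lemma L2_norm_squared_cong:
  "(\<And>x. x \<in> S \<Longrightarrow> norm (f x) = norm (g x)) \<Longrightarrow> (L2_norm S f)\<^sup>2 = (L2_norm S g)\<^sup>2"
  unfolding L2_norm_squared by (intro Bochner_Integration.integral_cong) auto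

lemma L2_I_bound:
  assumes "f \<in> borel_measurable (lebesgue_on S)" "integrable (lebesgue_on S) g"
    and "\<And>x. x \<in> S \<Longrightarrow> (norm (f x))\<^sup>2 \<le> g x"
  shows "f \<in> L2 S"
  unfolding L2_def
proof (safe intro!: assms(1))
  show "integrable (lebesgue_on S) (\<lambda>x. (norm (f x))\<^sup>2)"
  proof (rule Bochner_Integration.integrable_bound[OF assms(2)])
    show "(\<lambda>x. (norm (f x))\<^sup>2) \<in> borel_measurable (lebesgue_on S)"
      using assms(1) by measurable
    show "AE x in lebesgue_on S. norm ((norm (f x))\<^sup>2) \<le> norm (g x)"
      using assms(3) by (intro AE_I2) fastforce
  qed
qed

lemma L2_cong:
  assumes "\<And>x. x \<in> S \<Longrightarrow> f x = g x" "f \<in> L2 S"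
  shows "g \<in> L2 S"
proof (rule L2_I_bound[OF _ L2_integrable[OF assms(2)]])
  show "g \<in> borel_measurable (lebesgue_on S)"
    using L2_measurable[OF assms(2)] assms(1) by (subst measurable_cong[of _ _ f]) auto
qed (use assms(1) in auto)

lemma L2_zero: "(\<lambda>x. 0) \<in> L2 S"
  by (simp add: L2_def)

lemma L2_add:
  assumes "f \<in> L2 S" "g \<in> L2 S"
  shows "(\<lambda>x. f x + g x) \<in> L2 S"
  using L2_measurable[OF assms(1)] L2_measurable[OF assms(2)]
  by (intro L2_I_bound[where g = "\<lambda>x. 2 * (norm (f x))\<^sup>2 + 2 * (norm (g x))\<^sup>2"])
     (auto intro!: norm_add_squared_le L2_integrable assms)

lemma L2_cmult:
  fixes f :: "'a::euclidean_space \<Rightarrow> complex"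
  assumes "f \<in> L2 S"
  shows "(\<lambda>x. c * f x) \<in> L2 S"
  using L2_measurable[OF assms]
  by (intro L2_I_bound[where g = "\<lambda>x. (norm c)\<^sup>2 * (norm (f x))\<^sup>2"])
     (auto intro!: L2_integrable assms simp: norm_mult power_mult_distrib)

lemma L2_diff:
  fixes f g :: "'a::euclidean_space \<Rightarrow> complex"
  assumes "f \<in> L2 S" "g \<in> L2 S"
  shows "(\<lambda>x. f x - g x) \<in> L2 S"
  using L2_add[OF assms(1) L2_cmult[OF assms(2), of "-1"]] by simp

lemma L2_sum:
  assumes "\<And>i. i \<in> F \<Longrightarrow> f i \<in> L2 S"
  shows "(\<lambda>x. \<Sum>i\<in>F. f i x) \<in> L2 S"
  using assms by (induction F rule: infinite_finite_induct) (auto intro: L2_zero L2_add)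

lemma L2_bounded:
  assumes "S \<in> lmeasurable" "f \<in> borel_measurable (lebesgue_on S)"
    and "\<And>x. x \<in> S \<Longrightarrow> norm (f x) \<le> B"
  shows "f \<in> L2 S"
proof (rule L2_I_bound[OF assms(2)])
  interpret finite_measure "lebesgue_on S"
    by (rule finite_measure_lebesgue_on[OF assms(1)])
  show "integrable (lebesgue_on S) (\<lambda>_. B\<^sup>2)" by simp
qed (use assms(3) in \<open>auto intro!: power_mono\<close>)

lemma integrable_L2_mult_cnj:
  assumes "f \<in> L2 S" "g \<in> L2 S"
  shows "integrable (lebesgue_on S) (\<lambda>x. f x * cnj (g x))"
proof (rule Bochner_Integration.integrable_bound)
  show "integrable (lebesgue_on S) (\<lambda>x. (norm (f x))\<^sup>2 + (norm (g x))\<^sup>2)"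
    by (intro Bochner_Integration.integrable_add L2_integrable assms)
  note [measurable] = L2_measurable[OF assms(1)] L2_measurable[OF assms(2)]
  have [measurable]: "cnj \<in> borel_measurable borel"
    by (intro borel_measurable_continuous_onI continuous_intros)
  show "(\<lambda>x. f x * cnj (g x)) \<in> borel_measurable (lebesgue_on S)"
    by measurable
  have "a * b \<le> a\<^sup>2 + b\<^sup>2" if "a \<ge> 0" "b \<ge> 0" for a b :: real
    using sum_squares_bound[of a b] mult_nonneg_nonneg[OF that] by linarith
  then show "AE x in lebesgue_on S. norm (f x * cnj (g x)) \<le> norm ((norm (f x))\<^sup>2 + (norm (g x))\<^sup>2)"
    by (intro AE_I2) (simp add: norm_mult)
qed

lemma L2_inner_add_left:
  "f \<in> L2 S \<Longrightarrow> g \<in> L2 S \<Longrightarrow> k \<in> L2 S \<Longrightarrow>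
     L2_inner S (\<lambda>x. f x + g x) k = L2_inner S f k + L2_inner S g k"
  unfolding L2_inner_def by (simp add: distrib_right integrable_L2_mult_cnj)

lemma L2_inner_diff_left:
  "f \<in> L2 S \<Longrightarrow> g \<in> L2 S \<Longrightarrow> k \<in> L2 S \<Longrightarrow>
     L2_inner S (\<lambda>x. f x - g x) k = L2_inner S f k - L2_inner S g k"
  unfolding L2_inner_def by (simp add: left_diff_distrib integrable_L2_mult_cnj)

lemma L2_inner_cmult_left: "L2_inner S (\<lambda>x. c * f x) k = c * L2_inner S f k"
  unfolding L2_inner_def by (simp add: mult.assoc)

lemma L2_inner_sum_left:
  "(\<And>i. i \<in> F \<Longrightarrow> f i \<in> L2 S) \<Longrightarrow> k \<in> L2 S \<Longrightarrow>
     L2_inner S (\<lambda>x. \<Sum>i\<in>F. c i * f i x) k = (\<Sum>i\<in>F. c i * L2_inner S (f i) k)"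
  unfolding L2_inner_def 
  by (simp add: sum_distrib_right Bochner_Integration.integral_sum integrable_L2_mult_cnj mult.assoc)

lemma L2_inner_sum_right:
  "(\<And>i. i \<in> F \<Longrightarrow> f i \<in> L2 S) \<Longrightarrow> k \<in> L2 S \<Longrightarrow>
     L2_inner S k (\<lambda>x. \<Sum>i\<in>F. c i * f i x) = (\<Sum>i\<in>F. cnj (c i) * L2_inner S k (f i))"
  unfolding L2_inner_def
  by (simp add: sum_distrib_left Bochner_Integration.integral_sum integrable_L2_mult_cnj
      mult.left_commute[of "k _"])

lemma L2_norm_squared_add_eq:
  fixes f g :: "'a::euclidean_space \<Rightarrow> complex"
  assumes "f \<in> L2 S" "g \<in> L2 S"
  shows "(L2_norm S (\<lambda>x. f x + g x))\<^sup>2 =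
    (L2_norm S f)\<^sup>2 + (L2_norm S g)\<^sup>2 + 2 * Re (L2_inner S f g)"
proof -
  have eq: "(norm (a + b))\<^sup>2 = (norm a)\<^sup>2 + (norm b)\<^sup>2 + 2 * Re (a * cnj b)" for a b :: complex
    by (simp only: cmod_power2) (simp add: power2_eq_square algebra_simps)
  show ?thesis
    unfolding L2_norm_squared L2_inner_def eq integral_Re[OF integrable_L2_mult_cnj[OF assms], symmetric]
    using L2_integrable[OF assms(1)] L2_integrable[OF assms(2)]
      integrable_Re[OF integrable_L2_mult_cnj[OF assms]]
    by (simp del: times_complex.sel)
qed

lemma L2_norm_squared_add_le:
  assumes "f \<in> L2 S" "g \<in> L2 S"
  shows "(L2_norm S (\<lambda>x. f x + g x))\<^sup>2 \<le> 2 * (L2_norm S f)\<^sup>2 + 2 * (L2_norm S g)\<^sup>2"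
proof -
  have "(L2_norm S (\<lambda>x. f x + g x))\<^sup>2 \<le> (LINT x|lebesgue_on S. 2 * (norm (f x))\<^sup>2 + 2 * (norm (g x))\<^sup>2)"
    unfolding L2_norm_squared
    by (intro integral_mono L2_integrable L2_add assms norm_add_squared_le
        Bochner_Integration.integrable_add integrable_mult_right)
  then show ?thesis
    using assms by (simp add: L2_norm_squared L2_integrable)
qed

lemma L2_norm_cmult:
  fixes f :: "'a::euclidean_space \<Rightarrow> complex"
  shows "L2_norm S (\<lambda>x. c * f x) = norm c * L2_norm S f"
  by (simp add: L2_norm_def norm_mult power_mult_distrib real_sqrt_mult)

lemma L2_has_sum_iff_squared:
  "L2_has_sum S f s I \<longleftrightarrow>
     (\<forall>i\<in>I. f i \<in> L2 S) \<and> s \<in> L2 S \<and>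
     ((\<lambda>F. (L2_norm S (\<lambda>x. s x - (\<Sum>i\<in>F. f i x)))\<^sup>2) \<longlongrightarrow> 0) (finite_subsets_at_top I)"
proof -
  have "((\<lambda>F. u F) \<longlongrightarrow> 0) G \<longleftrightarrow> ((\<lambda>F. (u F)\<^sup>2) \<longlongrightarrow> 0) G" if "\<And>F. u F \<ge> 0"
    for u :: "'i set \<Rightarrow> real" and G
  proof
    assume "((\<lambda>F. (u F)\<^sup>2) \<longlongrightarrow> 0) G"
    from tendsto_real_sqrt[OF this] show "(u \<longlongrightarrow> 0) G" using that by simp
  qed (use tendsto_power[of u 0 G 2] in simp)
  from this[of "\<lambda>F. L2_norm S (\<lambda>x. s x - (\<Sum>i\<in>F. f i x))"] show ?thesis
    unfolding L2_has_sum_def by (simp add: L2_norm_def)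
qed

lemma L2_has_sum_add:
  fixes s t :: "'a::euclidean_space \<Rightarrow> complex"
  assumes "L2_has_sum S f s I" "L2_has_sum S g t I"
  shows "L2_has_sum S (\<lambda>i x. f i x + g i x) (\<lambda>x. s x + t x) I"
  unfolding L2_has_sum_iff_squared
proof (intro conjI ballI)
  let ?A = "\<lambda>F x. s x - (\<Sum>i\<in>F. f i x)" and ?B = "\<lambda>F x. t x - (\<Sum>i\<in>F. g i x)"
  note a = assms[unfolded L2_has_sum_iff_squared]
  have "((\<lambda>F. 2 * (L2_norm S (?A F))\<^sup>2 + 2 * (L2_norm S (?B F))\<^sup>2) \<longlongrightarrow> 2 * 0 + 2 * 0)
          (finite_subsets_at_top I)"
    using a by (intro tendsto_intros) auto
  then have lim: "((\<lambda>F. 2 * (L2_norm S (?A F))\<^sup>2 + 2 * (L2_norm S (?B F))\<^sup>2) \<longlongrightarrow> 0)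
          (finite_subsets_at_top I)" by simp
  show "((\<lambda>F. (L2_norm S (\<lambda>x. s x + t x - (\<Sum>i\<in>F. f i x + g i x)))\<^sup>2) \<longlongrightarrow> 0) (finite_subsets_at_top I)"
  proof (rule tendsto_sandwich[OF _ _ tendsto_const lim])
    show "\<forall>\<^sub>F F in finite_subsets_at_top I. (L2_norm S (\<lambda>x. s x + t x - (\<Sum>i\<in>F. f i x + g i x)))\<^sup>2
      \<le> 2 * (L2_norm S (?A F))\<^sup>2 + 2 * (L2_norm S (?B F))\<^sup>2"
    proof (rule eventually_finite_subsets_at_top_weakI)
      fix F assume F: "F \<subseteq> I"
      have eq: "(\<lambda>x. s x + t x - (\<Sum>i\<in>F. f i x + g i x)) = (\<lambda>x. ?A F x + ?B F x)"
        by (simp add: sum.distrib algebra_simps)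
      show "(L2_norm S (\<lambda>x. s x + t x - (\<Sum>i\<in>F. f i x + g i x)))\<^sup>2
        \<le> 2 * (L2_norm S (?A F))\<^sup>2 + 2 * (L2_norm S (?B F))\<^sup>2"
        unfolding eq using F a by (intro L2_norm_squared_add_le L2_diff L2_sum) auto
    qed
  qed auto
qed (use assms in \<open>auto simp: L2_has_sum_def intro: L2_add\<close>)

lemma L2_has_sum_zero:
  "L2_has_sum S (\<lambda>i x. 0) (\<lambda>x. 0) I"
  unfolding L2_has_sum_def by (simp add: L2_zero L2_norm_def)

lemma L2_has_sum_cmult:
  fixes s :: "'a::euclidean_space \<Rightarrow> complex"
  assumes "L2_has_sum S f s I"
  shows "L2_has_sum S (\<lambda>i x. c * f i x) (\<lambda>x. c * s x) I"
proof -
  have "L2_norm S (\<lambda>x. c * s x - (\<Sum>i\<in>F. c * f i x)) =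
        norm c * L2_norm S (\<lambda>x. s x - (\<Sum>i\<in>F. f i x))" for F
    by (simp add: sum_distrib_left[symmetric] right_diff_distrib[symmetric] L2_norm_cmult)
  then show ?thesis
    using assms unfolding L2_has_sum_def by (auto intro: L2_cmult tendsto_mult_right_zero)
qed

lemma L2_has_sum_sum:
  fixes s :: "'l \<Rightarrow> 'a::euclidean_space \<Rightarrow> complex"
  assumes "\<And>l. l \<in> A \<Longrightarrow> L2_has_sum S (f l) (s l) I"
  shows "L2_has_sum S (\<lambda>i x. \<Sum>l\<in>A. f l i x) (\<lambda>x. \<Sum>l\<in>A. s l x) I"
  using assms
  by (induction A rule: infinite_finite_induct) (auto intro: L2_has_sum_zero L2_has_sum_add)

text \<open>
  The Euclidean norm makes vector-valued \<open>L2\<close> the Hilbert sum of its components, so that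
  unconditional convergence can be checked one component at a time.
\<close>

lemma norm_vec_squared: "(norm (v :: complex ^ 'g::finite))\<^sup>2 = (\<Sum>g\<in>UNIV. (norm (v $ g))\<^sup>2)"
  by (simp add: norm_vec_def L2_set_def sum_nonneg)

lemma L2_vecI:
  fixes s :: "'a::euclidean_space \<Rightarrow> complex ^ 'g::finite"
  assumes "\<And>g. (\<lambda>x. s x $ g) \<in> L2 S"
  shows "s \<in> L2 S"
proof (rule L2_I_bound)
  have "(\<lambda>x. s x \<bullet> b) \<in> borel_measurable (lebesgue_on S)" if "b \<in> Basis" for b
  proof -
    from that obtain g u where b: "b = axis g u" by (auto simp: Basis_vec_def)
    have "(\<lambda>x. s x $ g \<bullet> u) \<in> borel_measurable (lebesgue_on S)"
      using L2_measurable[OF assms[of g]] by measurable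
    then show ?thesis by (simp add: b inner_axis)
  qed
  then show "s \<in> borel_measurable (lebesgue_on S)"
    by (subst borel_measurable_euclidean_space) auto
  show "integrable (lebesgue_on S) (\<lambda>x. \<Sum>g\<in>UNIV. (norm (s x $ g))\<^sup>2)"
    by (intro Bochner_Integration.integrable_sum L2_integrable assms)
qed (simp add: norm_vec_squared)

lemma L2_has_sum_vecI:
  fixes s :: "'a::euclidean_space \<Rightarrow> complex ^ 'g::finite"
  assumes "\<And>g. L2_has_sum S (\<lambda>i x. f i x $ g) (\<lambda>x. s x $ g) I"
  shows "L2_has_sum S f s I"
  unfolding L2_has_sum_iff_squared
proof (intro conjI ballI)
  note a = assms[unfolded L2_has_sum_iff_squared]
  let ?R = "\<lambda>F g x. s x $ g - (\<Sum>i\<in>F. f i x $ g)"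
  have "((\<lambda>F. \<Sum>g\<in>UNIV. (L2_norm S (?R F g))\<^sup>2) \<longlongrightarrow> (\<Sum>g\<in>(UNIV::'g set). 0)) (finite_subsets_at_top I)"
    using a by (intro tendsto_sum) auto
  then have "((\<lambda>F. \<Sum>g\<in>UNIV. (L2_norm S (?R F g))\<^sup>2) \<longlongrightarrow> 0) (finite_subsets_at_top I)" by simp
  moreover have "\<forall>\<^sub>F F in finite_subsets_at_top I.
      (\<Sum>g\<in>UNIV. (L2_norm S (?R F g))\<^sup>2) = (L2_norm S (\<lambda>x. s x - (\<Sum>i\<in>F. f i x)))\<^sup>2"
  proof (rule eventually_finite_subsets_at_top_weakI)
    fix F assume F: "F \<subseteq> I"
    have R: "?R F g \<in> L2 S" for g
      using F a by (intro L2_diff L2_sum) auto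
    show "(\<Sum>g\<in>UNIV. (L2_norm S (?R F g))\<^sup>2) = (L2_norm S (\<lambda>x. s x - (\<Sum>i\<in>F. f i x)))\<^sup>2"
      unfolding L2_norm_squared norm_vec_squared
      by (subst Bochner_Integration.integral_sum) (auto intro: L2_integrable[OF R])
  qed
  ultimately show "((\<lambda>F. (L2_norm S (\<lambda>x. s x - (\<Sum>i\<in>F. f i x)))\<^sup>2) \<longlongrightarrow> 0) (finite_subsets_at_top I)"
    by (rule Lim_transform_eventually)
qed (use assms in \<open>auto simp: L2_has_sum_def intro: L2_vecI\<close>)

section \<open>Expansions in an orthonormal system\<close>

locale L2_orthonormal =
  fixes S :: "'a::euclidean_space set" and e :: "'i \<Rightarrow> 'a \<Rightarrow> complex"
  assumes e_in_L2: "e i \<in> L2 S"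
    and orthonormal: "L2_inner S (e i) (e j) = (if i = j then 1 else 0)"
begin

definition partial_sum :: "('a \<Rightarrow> complex) \<Rightarrow> 'i set \<Rightarrow> 'a \<Rightarrow> complex" where
  "partial_sum f F = (\<lambda>x. \<Sum>i\<in>F. L2_inner S f (e i) * e i x)"

definition expands :: "('a \<Rightarrow> complex) \<Rightarrow> bool" where
  "expands f \<longleftrightarrow> L2_has_sum S (\<lambda>i x. L2_inner S f (e i) * e i x) f UNIV"

lemma expands_L2: "expands f \<Longrightarrow> f \<in> L2 S"
  by (simp add: expands_def L2_has_sum_def)

lemma partial_sum_L2: "partial_sum f F \<in> L2 S"
  unfolding partial_sum_def by (intro L2_sum L2_cmult e_in_L2)

lemma expands_iff:
  "expands f \<longleftrightarrow> f \<in> L2 S \<and>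
     ((\<lambda>F. (L2_norm S (\<lambda>x. f x - partial_sum f F x))\<^sup>2) \<longlongrightarrow> 0) (finite_subsets_at_top UNIV)"
  unfolding expands_def L2_has_sum_iff_squared by (auto simp: partial_sum_def intro!: L2_cmult e_in_L2)

lemma partial_sum_diff:
  "f \<in> L2 S \<Longrightarrow> g \<in> L2 S \<Longrightarrow>
     partial_sum (\<lambda>x. f x - g x) F x = partial_sum f F x - partial_sum g F x"
  by (simp add: partial_sum_def L2_inner_diff_left e_in_L2 left_diff_distrib sum_subtractf)

text \<open>
  Bessel's inequality in the form that is used here: the residual of a partial sum is orthogonal
  to the partial sum, so passing to the residual never increases the norm.
\<close>

lemma L2_norm_residual_le:
  assumes f: "f \<in> L2 S" and F: "finite F"
  shows "(L2_norm S (\<lambda>x. f x - partial_sum f F x))\<^sup>2 \<le> (L2_norm S f)\<^sup>2"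
proof -
  let ?s = "partial_sum f F"
  let ?r = "\<lambda>x. f x - ?s x"
  have r: "?r \<in> L2 S" by (intro L2_diff f partial_sum_L2)
  have "L2_inner S ?r (e i) = 0" if "i \<in> F" for i
  proof -
    have "L2_inner S ?s (e i) = (\<Sum>j\<in>F. L2_inner S f (e j) * L2_inner S (e j) (e i))"
      unfolding partial_sum_def by (intro L2_inner_sum_left e_in_L2)
    also have "\<dots> = L2_inner S f (e i)"
      using F that by (simp add: orthonormal if_distrib[of "\<lambda>c. _ * c"] cong: if_cong)
    finally show ?thesis
      by (simp add: L2_inner_diff_left f partial_sum_L2 e_in_L2)
  qed
  then have "L2_inner S ?r ?s = 0"
    unfolding partial_sum_def[of f F]
    by (subst L2_inner_sum_right) (auto intro: e_in_L2 r[unfolded partial_sum_def] simp: partial_sum_def)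
  then have "(L2_norm S (\<lambda>x. ?r x + ?s x))\<^sup>2 = (L2_norm S ?r)\<^sup>2 + (L2_norm S ?s)\<^sup>2"
    using L2_norm_squared_add_eq[OF r partial_sum_L2[of f F]] by simp
  then show ?thesis by simp
qed

lemma expands_add: "expands f \<Longrightarrow> expands g \<Longrightarrow> expands (\<lambda>x. f x + g x)"
  using L2_has_sum_add[of S "\<lambda>i x. L2_inner S f (e i) * e i x" f UNIV "\<lambda>i x. L2_inner S g (e i) * e i x" g]
    expands_L2[of f] expands_L2[of g]
  by (simp add: expands_def L2_inner_add_left e_in_L2 distrib_right)

lemma expands_cmult: "expands f \<Longrightarrow> expands (\<lambda>x. c * f x)"
  using L2_has_sum_cmult[of S "\<lambda>i x. L2_inner S f (e i) * e i x" f UNIV c]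
  by (simp add: expands_def L2_inner_cmult_left mult.assoc)

lemma expands_sum:
  "(\<And>i. i \<in> A \<Longrightarrow> expands (f i)) \<Longrightarrow> expands (\<lambda>x. \<Sum>i\<in>A. f i x)"
proof (induction A rule: infinite_finite_induct)
  case (infinite A)
  then show ?case by (simp add: expands_def L2_inner_def L2_has_sum_zero)
next
  case empty
  show ?case by (simp add: expands_def L2_inner_def L2_has_sum_zero)
qed (auto intro: expands_add)

lemma expands_basis: "expands (e i)"
  unfolding expands_iff
proof
  have "\<forall>\<^sub>F F in finite_subsets_at_top UNIV. (L2_norm S (\<lambda>x. e i x - partial_sum (e i) F x))\<^sup>2 = 0"
    unfolding eventually_finite_subsets_at_top
    by (intro exI[of _ "{i}"])
       (auto simp: partial_sum_def orthonormal L2_norm_def if_distrib[of "\<lambda>c. c * _"] cong: if_cong)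
  then show "((\<lambda>F. (L2_norm S (\<lambda>x. e i x - partial_sum (e i) F x))\<^sup>2) \<longlongrightarrow> 0) (finite_subsets_at_top UNIV)"
    by (rule tendsto_eventually)
qed (rule e_in_L2)

text \<open>
  The functions that equal their expansion form a closed subspace. If \<open>p\<close> is close to \<open>f\<close>, then the
  residual of \<open>f\<close> is the residual of \<open>f - p\<close>, which is small by Bessel's inequality whatever the index
  set, plus the residual of \<open>p\<close>, which tends to 0. Completeness of the system therefore
  reduces to approximating every \<open>L2\<close> function by functions already known to equal their expansion.
\<close>

lemma expands_approx:
  assumes f: "f \<in> L2 S"
    and approx: "\<And>\<epsilon>. \<epsilon> > 0 \<Longrightarrow> \<exists>p. expands p \<and> (L2_norm S (\<lambda>x. f x - p x))\<^sup>2 < \<epsilon>"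
  shows "expands f"
  unfolding expands_iff
proof
  show "((\<lambda>F. (L2_norm S (\<lambda>x. f x - partial_sum f F x))\<^sup>2) \<longlongrightarrow> 0) (finite_subsets_at_top UNIV)"
  proof (rule tendstoI)
    fix \<epsilon> :: real assume "\<epsilon> > 0"
    then obtain p where p: "expands p" "(L2_norm S (\<lambda>x. f x - p x))\<^sup>2 < \<epsilon> / 4"
      using approx[of "\<epsilon> / 4"] by auto
    let ?d = "\<lambda>x. f x - p x"
    have pL: "p \<in> L2 S" and dL: "?d \<in> L2 S"
      using expands_L2[OF p(1)] f by (auto intro: L2_diff)
    have "\<forall>\<^sub>F F in finite_subsets_at_top UNIV. (L2_norm S (\<lambda>x. p x - partial_sum p F x))\<^sup>2 < \<epsilon> / 4"
      using p(1) \<open>\<epsilon> > 0\<close> unfolding expands_iff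
      by (intro order_tendstoD(2)[where y = 0]) auto
    moreover have "\<forall>\<^sub>F F in finite_subsets_at_top (UNIV :: 'i set). finite F"
      by (rule eventually_finite_subsets_at_top_weakI)
    ultimately show "\<forall>\<^sub>F F in finite_subsets_at_top UNIV.
        dist ((L2_norm S (\<lambda>x. f x - partial_sum f F x))\<^sup>2) 0 < \<epsilon>"
    proof eventually_elim
      case (elim F)
      have eq: "(\<lambda>x. f x - partial_sum f F x) =
                (\<lambda>x. (?d x - partial_sum ?d F x) + (p x - partial_sum p F x))"
        by (simp add: partial_sum_diff f pL)
      have "(L2_norm S (\<lambda>x. f x - partial_sum f F x))\<^sup>2
          \<le> 2 * (L2_norm S (\<lambda>x. ?d x - partial_sum ?d F x))\<^sup>2 + 2 * (L2_norm S (\<lambda>x. p x - partial_sum p F x))\<^sup>2"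
        unfolding eq by (intro L2_norm_squared_add_le L2_diff partial_sum_L2 dL pL f)
      also have "\<dots> \<le> 2 * (L2_norm S ?d)\<^sup>2 + 2 * (L2_norm S (\<lambda>x. p x - partial_sum p F x))\<^sup>2"
        using L2_norm_residual_le[OF dL, of F] elim by simp
      also have "\<dots> < \<epsilon>" using p(2) elim by simp
      finally show ?case by simp
    qed
  qed
qed (rule f)

lemma expands_cong:
  assumes "expands f" "\<And>x. x \<in> S \<Longrightarrow> g x = f x"
  shows "expands g"
proof (rule expands_approx)
  show "g \<in> L2 S" using L2_cong[OF _ expands_L2[OF assms(1)]] assms(2) by metis
  have "(L2_norm S (\<lambda>x. g x - f x))\<^sup>2 = (L2_norm S (\<lambda>x. 0 :: complex))\<^sup>2"
    by (rule L2_norm_squared_cong) (simp add: assms(2))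
  then show "\<exists>p. expands p \<and> (L2_norm S (\<lambda>x. g x - p x))\<^sup>2 < \<epsilon>" if "\<epsilon> > 0" for \<epsilon>
    using assms(1) that by (intro exI[of _ f]) (simp add: L2_norm_def)
qed

lemma expands_dominated_limit:
  assumes f: "f \<in> L2 S" and p: "\<And>n::nat. expands (p n)"
    and lim: "\<And>x. x \<in> S \<Longrightarrow> (\<lambda>n. p n x) \<longlonglongrightarrow> f x"
    and G: "integrable (lebesgue_on S) G"
    and bound: "\<And>n x. x \<in> S \<Longrightarrow> (norm (f x - p n x))\<^sup>2 \<le> G x"
  shows "expands f"
proof (rule expands_approx[OF f])
  have "(\<lambda>n. LINT x|lebesgue_on S. (norm (f x - p n x))\<^sup>2) \<longlonglongrightarrow> (LINT x|lebesgue_on S. 0)"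
  proof (rule integral_dominated_convergence[OF _ _ G])
    show "(\<lambda>x. (norm (f x - p n x))\<^sup>2) \<in> borel_measurable (lebesgue_on S)" for n
      using L2_measurable[OF f] L2_measurable[OF expands_L2[OF p[of n]]] by measurable
    show "AE x in lebesgue_on S. (\<lambda>n. (norm (f x - p n x))\<^sup>2) \<longlonglongrightarrow> 0"
    proof (rule AE_I2)
      fix x assume "x \<in> space (lebesgue_on S)"
      then have "(\<lambda>n. p n x) \<longlonglongrightarrow> f x" using lim by simp
      then have "(\<lambda>n. (norm (f x - p n x))\<^sup>2) \<longlonglongrightarrow> (norm (f x - f x))\<^sup>2"
        by (intro tendsto_intros)
      then show "(\<lambda>n. (norm (f x - p n x))\<^sup>2) \<longlonglongrightarrow> 0" by simp
    qed
    show "AE x in lebesgue_on S. norm ((norm (f x - p n x))\<^sup>2) \<le> G x" for n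
      using bound by (intro AE_I2) simp
  qed simp
  then have lim2: "(\<lambda>n. (L2_norm S (\<lambda>x. f x - p n x))\<^sup>2) \<longlonglongrightarrow> 0"
    by (simp add: L2_norm_squared)
  fix \<epsilon> :: real assume "\<epsilon> > 0"
  from order_tendstoD(2)[OF lim2 this] obtain n where "(L2_norm S (\<lambda>x. f x - p n x))\<^sup>2 < \<epsilon>"
    by (auto simp: eventually_sequentially)
  with p show "\<exists>p. expands p \<and> (L2_norm S (\<lambda>x. f x - p x))\<^sup>2 < \<epsilon>" by blast
qed

end

section \<open>Translation modulo the period lattice preserves measure\<close>

lemma Omega_eq_cbox: "Omega T = cbox (-T, -T) (T, T)"
  by (simp add: Omega_def cbox_Pair_eq)

lemma Omega_lmeasurable: "Omega T \<in> lmeasurable"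
  unfolding Omega_eq_cbox by simp

lemma Omega_sets: "Omega T \<in> sets lebesgue"
  unfolding Omega_eq_cbox by simp

definition lattice_point :: "real \<Rightarrow> int \<times> int \<Rightarrow> real \<times> real" where
  "lattice_point T k = (2 * T * of_int (fst k), 2 * T * of_int (snd k))"

text \<open>
  The half-open squares with side \<open>2 * T\<close> centred at the points of the period lattice tile the plane;
  \<open>cell T r\<close> is the index of the tile containing \<open>r\<close>.
\<close>

definition cell :: "real \<Rightarrow> real \<times> real \<Rightarrow> int \<times> int" where
  "cell T r = (\<lfloor>(fst r + T) / (2 * T)\<rfloor>, \<lfloor>(snd r + T) / (2 * T)\<rfloor>)"

definition wrap :: "real \<Rightarrow> real \<times> real \<Rightarrow> real \<times> real" where
  "wrap T r = r - lattice_point T (cell T r)"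

lemma periodic_ext_eq: "periodic_ext T f r = f (wrap T r)"
  by (cases r) (simp add: periodic_ext_def wrap_def lattice_point_def cell_def)

lemma cell_eq_iff:
  assumes "T > 0"
  shows "cell T r = (m, n) \<longleftrightarrow>
     2 * T * of_int m - T \<le> fst r \<and> fst r < 2 * T * of_int m + T \<and>
     2 * T * of_int n - T \<le> snd r \<and> snd r < 2 * T * of_int n + T"
  using assms by (auto simp: cell_def floor_eq_iff field_simps)

lemma cell_zero_subset:
  assumes "T > 0" shows "{r. cell T r = 0} \<subseteq> Omega T"
  using assms by (auto simp: zero_prod_def cell_eq_iff Omega_def)

lemma cell_add_lattice_point:
  assumes "T > 0" shows "cell T (r + lattice_point T k) = cell T r + k"
proof -
  have "\<lfloor>(x + 2 * T * of_int m + T) / (2 * T)\<rfloor> = \<lfloor>(x + T) / (2 * T)\<rfloor> + m" for x m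
  proof -
    have "(x + 2 * T * of_int m + T) / (2 * T) = (x + T) / (2 * T) + of_int m"
      using assms by (simp add: field_simps)
    then show ?thesis by simp
  qed
  then show ?thesis by (simp add: cell_def lattice_point_def plus_prod_def)
qed

lemma lattice_point_minus: "lattice_point T (- k) = - lattice_point T k"
  by (simp add: lattice_point_def)

lemma cell_wrap: "T > 0 \<Longrightarrow> cell T (wrap T r) = 0"
  using cell_add_lattice_point[of T r "- cell T r"] by (simp add: wrap_def lattice_point_minus)

lemma wrap_in_Omega: "T > 0 \<Longrightarrow> wrap T r \<in> Omega T"
  using cell_wrap[of T r] cell_zero_subset[of T] by auto

lemma cell_borel:
  assumes "T > 0" shows "{r. cell T r = k} \<in> sets borel"
proof -
  obtain m n where k: "k = (m, n)" by (cases k)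
  have "{r. cell T r = k} = {2 * T * of_int m - T..<2 * T * of_int m + T} \<times>
                            {2 * T * of_int n - T..<2 * T * of_int n + T}"
    unfolding k cell_eq_iff[OF assms] by force
  also have "\<dots> \<in> sets borel" by (intro borel_Times) auto
  finally show ?thesis .
qed

lemma mem_box_square:
  "r \<in> box (-T, -T) (T, T) \<longleftrightarrow> -T < fst r \<and> fst r < T \<and> -T < snd r \<and> snd r < (T::real)"
  by (cases r) (auto simp: mem_box Basis_prod_def)

lemma Omega_minus_cell_null:
  assumes "T > 0" shows "Omega T - {r. cell T r = 0} \<in> null_sets lebesgue"
proof -
  have "Omega T - {r. cell T r = 0} \<subseteq> frontier (Omega T)"
    using assms unfolding Omega_eq_cbox frontier_cbox
    by (auto simp: zero_prod_def cell_eq_iff mem_box_square)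
  moreover have "frontier (Omega T) \<in> null_sets lebesgue"
    unfolding Omega_eq_cbox negligible_iff_null_sets[symmetric]
    by (rule negligible_convex_frontier) (rule convex_box)
  ultimately show ?thesis
    using null_sets_completion_subset by blast
qed

lemma emeasure_translation:
  fixes S :: "'a::euclidean_space set"
  shows "emeasure lebesgue ((\<lambda>x. x + a) ` S) = emeasure lebesgue S"
  using emeasure_lebesgue_affine[of 1 a S] by simp

lemma sets_translation:
  fixes S :: "'a::euclidean_space set"
  shows "S \<in> sets lebesgue \<Longrightarrow> (\<lambda>x. x + a) ` S \<in> sets lebesgue"
  using lebesgue_sets_translation[of S a] by (simp add: add.commute)

lemma shift_image:
  fixes s :: "'a::group_add"
  shows "(\<lambda>u. u + s) ` {u. P u} = {u. P (u - s)}"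
  by (auto simp: image_iff) (metis diff_add_cancel)

text \<open>
  Cut the preimage according to the tile \<open>k\<close> that contains \<open>r + s\<close>. On each piece the map is the
  translation by \<open>s - lattice_point T k\<close>, and its image consists of the points \<open>u\<close> of \<open>A\<close> in tile 0
  for which \<open>u - s\<close> lies in tile \<open>- k\<close>.
\<close>

lemma wrap_shift_eq_iff:
  assumes "T > 0"
  shows "{r. cell T r = 0 \<and> wrap T (r + s) \<in> A} =
         (\<Union>k. (\<lambda>u. u + (lattice_point T k - s)) ` {u \<in> A. cell T u = 0 \<and> cell T (u - s) = - k})"
    (is "?L = (\<Union>k. ?R k)")
proof (intro equalityI subsetI)
  fix r assume r: "r \<in> ?L"
  define k where "k = cell T (r + s)"
  define u where "u = wrap T (r + s)"
  have ru: "r = u + (lattice_point T k - s)" by (simp add: u_def k_def wrap_def)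
  have "u - s = r + lattice_point T (- k)" by (simp add: ru lattice_point_minus)
  then have "cell T (u - s) = - k"
    using r cell_add_lattice_point[OF assms, of r "-k"] by simp
  moreover have "u \<in> A" "cell T u = 0" using r cell_wrap[OF assms] by (auto simp: u_def)
  ultimately have "r \<in> ?R k" using ru by blast
  then show "r \<in> (\<Union>k. ?R k)" by blast
next
  fix r assume "r \<in> (\<Union>k. ?R k)"
  then obtain k u where u: "u \<in> A" "cell T u = 0" "cell T (u - s) = - k"
    and ru: "r = u + (lattice_point T k - s)" by auto
  have "cell T r = 0"
    using cell_add_lattice_point[OF assms, of "u - s" k] u(3) by (simp add: ru algebra_simps)
  moreover have "cell T (r + s) = k"
  proof -
    have "r + s = u + lattice_point T k" by (simp add: ru)
    then show ?thesis using cell_add_lattice_point[OF assms, of u k] u(2) by (metis add_0)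
  qed
  ultimately show "r \<in> ?L" using u(1) by (simp add: wrap_def ru)
qed

text \<open>
  Both the pieces of the preimage and their translates are disjoint, the former because they are
  separated by the tile of \<open>r + s\<close>, the latter because they are separated by the tile of \<open>u - s\<close>.
  Hence translation invariance of Lebesgue measure on each piece and countable additivity suffice.
\<close>

lemma wrap_shift_vimage:
  assumes T: "T > 0" and A: "A \<in> sets lebesgue" "A \<subseteq> Omega T"
  shows "{r. cell T r = 0 \<and> wrap T (r + s) \<in> A} \<in> sets lebesgue" (is "?L \<in> _")
    and "emeasure lebesgue {r. cell T r = 0 \<and> wrap T (r + s) \<in> A} = emeasure lebesgue A"
proof -
  define P where "P k = {u \<in> A. cell T u = 0 \<and> cell T (u - s) = - k}" for k
  define R where "R k = (\<lambda>u. u + (lattice_point T k - s)) ` P k" for k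
  have L: "?L = (\<Union>k. R k)" unfolding R_def P_def by (rule wrap_shift_eq_iff[OF T])
  have C: "{u. cell T u = k} \<in> sets lebesgue" for k using cell_borel[OF T] by simp
  have "{u. cell T (u - s) = - k} = (\<lambda>u. u + s) ` {u. cell T u = - k}" for k
    by (rule shift_image[symmetric])
  then have "{u. cell T (u - s) = - k} \<in> sets lebesgue" for k
    using sets_translation[OF C] by simp
  moreover have "P k = A \<inter> {u. cell T u = 0} \<inter> {u. cell T (u - s) = - k}" for k
    by (auto simp: P_def)
  ultimately have P: "P k \<in> sets lebesgue" for k using A(1) C by (auto intro!: sets.Int)
  then have R: "R k \<in> sets lebesgue" for k unfolding R_def by (rule sets_translation)
  show "?L \<in> sets lebesgue" unfolding L using R by (intro sets.countable_UN'') auto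
  have cell_R: "cell T (r + s) = k" if "r \<in> R k" for r k
  proof -
    from that obtain u where u: "r = u + (lattice_point T k - s)" "cell T u = 0"
      unfolding R_def P_def by blast
    have "r + s = u + lattice_point T k" by (simp add: u(1))
    then show ?thesis using cell_add_lattice_point[OF T, of u k] u(2) by (metis add_0)
  qed
  have "emeasure lebesgue ?L = (\<integral>\<^sup>+k. emeasure lebesgue (R k) \<partial>count_space UNIV)"
    unfolding L
  proof (rule emeasure_UN_countable)
    show "disjoint_family R" using cell_R unfolding disjoint_family_on_def by blast
  qed (use R in auto)
  also have "\<dots> = (\<integral>\<^sup>+k. emeasure lebesgue (P k) \<partial>count_space UNIV)"
    unfolding R_def emeasure_translation ..
  also have "\<dots> = emeasure lebesgue (\<Union>k. P k)"
    using P by (intro emeasure_UN_countable[symmetric]) (auto simp: disjoint_family_on_def P_def)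
  also have "(\<Union>k. P k) = A - (Omega T - {r. cell T r = 0})"
  proof -
    have "u \<in> P (- cell T (u - s))" if "u \<in> A" "cell T u = 0" for u
      using that by (simp add: P_def)
    moreover have "u \<in> A \<and> cell T u = 0" if "u \<in> P k" for u k
      using that by (simp add: P_def)
    ultimately show ?thesis using A(2) by blast
  qed
  also have "emeasure lebesgue \<dots> = emeasure lebesgue A"
    by (rule emeasure_Diff_null_set[OF Omega_minus_cell_null[OF T] A(1)])
  finally show "emeasure lebesgue ?L = emeasure lebesgue A" .
qed

lemma wrap_shift_measurable:
  assumes T: "T > 0"
  shows "(\<lambda>r. wrap T (r + s)) \<in> lebesgue_on (Omega T) \<rightarrow>\<^sub>M lebesgue_on (Omega T)"
    and "distr (lebesgue_on (Omega T)) (lebesgue_on (Omega T)) (\<lambda>r. wrap T (r + s)) = lebesgue_on (Omega T)"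
proof -
  let ?M = "lebesgue_on (Omega T)" and ?f = "\<lambda>r. wrap T (r + s)"
  let ?N = "Omega T - {r. cell T r = 0}"
  have *: "?f -` A \<inter> Omega T \<in> sets lebesgue"
          "emeasure lebesgue (?f -` A \<inter> Omega T) = emeasure lebesgue A"
    if A: "A \<in> sets lebesgue" "A \<subseteq> Omega T" for A
  proof -
    let ?X = "{r. cell T r = 0 \<and> ?f r \<in> A}"
    have eq: "?f -` A \<inter> Omega T = ?X \<union> (?N \<inter> ?f -` A)"
      using cell_zero_subset[OF T] by auto
    have N: "?N \<inter> ?f -` A \<in> null_sets lebesgue"
      using Omega_minus_cell_null[OF T] by (rule null_sets_completion_subset[rotated]) auto
    show "?f -` A \<inter> Omega T \<in> sets lebesgue"
      unfolding eq by (intro sets.Un wrap_shift_vimage(1)[OF T A] null_setsD2[OF N])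
    show "emeasure lebesgue (?f -` A \<inter> Omega T) = emeasure lebesgue A"
      unfolding eq emeasure_Un_null_set[OF wrap_shift_vimage(1)[OF T A] N]
      by (rule wrap_shift_vimage(2)[OF T A])
  qed
  have sets: "A \<in> sets ?M \<longleftrightarrow> A \<in> sets lebesgue \<and> A \<subseteq> Omega T" for A
    using sets_restrict_space_iff[of "Omega T" lebesgue A] Omega_sets by auto
  have em: "emeasure ?M A = emeasure lebesgue A" if "A \<subseteq> Omega T" for A
    using that Omega_sets by (intro emeasure_restrict_space) auto
  show meas: "?f \<in> ?M \<rightarrow>\<^sub>M ?M"
    by (intro measurableI) (auto simp: sets * wrap_in_Omega[OF T])
  show "distr ?M ?M ?f = ?M"
  proof (rule measure_eqI)
    fix A assume "A \<in> sets (distr ?M ?M ?f)"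
    then have A: "A \<in> sets ?M" by simp
    have "emeasure (distr ?M ?M ?f) A = emeasure ?M (?f -` A \<inter> Omega T)"
      using emeasure_distr[OF meas A] by simp
    also have "\<dots> = emeasure ?M A"
      using A unfolding sets by (subst (1 2) em) (auto simp only: *)
    finally show "emeasure (distr ?M ?M ?f) A = emeasure ?M A" .
  qed simp
qed

lemma integral_wrap_shift:
  fixes f :: "real \<times> real \<Rightarrow> 'b::{banach, second_countable_topology}"
  assumes T: "T > 0" and f: "f \<in> borel_measurable (lebesgue_on (Omega T))"
  shows "(LINT r|lebesgue_on (Omega T). f (wrap T (r + s))) = (LINT r|lebesgue_on (Omega T). f r)"
  using integral_distr[OF wrap_shift_measurable(1)[OF T] f] by (simp add: wrap_shift_measurable(2)[OF T])

lemma L2_wrap_shift: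
  fixes f :: "real \<times> real \<Rightarrow> complex"
  assumes T: "T > 0" and f: "f \<in> L2 (Omega T)"
  shows "(\<lambda>r. f (wrap T (r + s))) \<in> L2 (Omega T)"
    and "L2_norm (Omega T) (\<lambda>r. f (wrap T (r + s))) = L2_norm (Omega T) f"
proof -
  note m = wrap_shift_measurable(1)[OF T, of s]
  have n: "(\<lambda>r. (norm (f r))\<^sup>2) \<in> borel_measurable (lebesgue_on (Omega T))"
    using L2_measurable[OF f] by measurable
  show "(\<lambda>r. f (wrap T (r + s))) \<in> L2 (Omega T)"
    unfolding L2_def using measurable_compose[OF m L2_measurable[OF f]]
      integrable_distr[OF m, of "\<lambda>r. (norm (f r))\<^sup>2"] L2_integrable[OF f]
    by (simp add: wrap_shift_measurable(2)[OF T])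
  show "L2_norm (Omega T) (\<lambda>r. f (wrap T (r + s))) = L2_norm (Omega T) f"
    unfolding L2_norm_def using integral_wrap_shift[OF T n] by simp
qed

section \<open>Scaling of Lebesgue measure on a set\<close>

lemma lebesgue_on_scaling:
  fixes S :: "'a::euclidean_space set"
  assumes c: "c > 0" and S: "S \<in> sets lebesgue"
  shows "(\<lambda>x. c *\<^sub>R x) \<in> lebesgue_on S \<rightarrow>\<^sub>M lebesgue_on ((\<lambda>x. c *\<^sub>R x) ` S)" (is "?f \<in> ?M \<rightarrow>\<^sub>M ?N")
    and "lebesgue_on ((\<lambda>x. c *\<^sub>R x) ` S) =
      density (distr (lebesgue_on S) (lebesgue_on ((\<lambda>x. c *\<^sub>R x) ` S)) (\<lambda>x. c *\<^sub>R x))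
        (\<lambda>_. ennreal (c ^ DIM('a)))"
    and "(\<lambda>x. c *\<^sub>R x) ` S \<in> sets lebesgue"
proof -
  let ?cS = "?f ` S"
  have "?cS = (\<lambda>x. (1 / c) *\<^sub>R x) -` S \<inter> space lebesgue"
    using c by (force simp: image_iff)
  then show cS: "?cS \<in> sets lebesgue"
    using measurable_sets[OF lebesgue_measurable_scaling S] by metis
  show meas: "?f \<in> ?M \<rightarrow>\<^sub>M ?N"
    by (intro measurable_restrict_space3 lebesgue_measurable_scaling) auto
  show "?N = density (distr ?M ?N ?f) (\<lambda>_. ennreal (c ^ DIM('a)))"
  proof (rule measure_eqI)
    fix A assume A: "A \<in> sets ?N"
    then have A': "A \<in> sets lebesgue" "A \<subseteq> ?cS"
      using sets_restrict_space_iff[of ?cS lebesgue A] cS by auto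
    let ?B = "?f -` A \<inter> S"
    have AB: "A = ?f ` ?B" using A'(2) by blast
    have "emeasure ?N A = emeasure lebesgue A"
      using A' cS by (intro emeasure_restrict_space) auto
    also have "\<dots> = ennreal (c ^ DIM('a)) * emeasure lebesgue ?B"
      using emeasure_lebesgue_affine[of c 0 ?B] AB c by (simp add: ennreal_power)
    also have "emeasure lebesgue ?B = emeasure ?M ?B"
      using S by (intro emeasure_restrict_space[symmetric]) auto
    also have "\<dots> = emeasure (distr ?M ?N ?f) A"
      using emeasure_distr[OF meas A] by simp
    also have "ennreal (c ^ DIM('a)) * \<dots> = emeasure (density (distr ?M ?N ?f) (\<lambda>_. ennreal (c ^ DIM('a)))) A"
      using A by (subst emeasure_density) (auto simp: nn_integral_cmult_indicator)
    finally show "emeasure ?N A = emeasure (density (distr ?M ?N ?f) (\<lambda>_. ennreal (c ^ DIM('a)))) A" .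
  qed simp
qed

lemma
  fixes S :: "'a::euclidean_space set" and f :: "'a \<Rightarrow> 'b::{banach, second_countable_topology}"
  assumes c: "c > 0" and S: "S \<in> sets lebesgue"
    and f: "f \<in> borel_measurable (lebesgue_on ((\<lambda>x. c *\<^sub>R x) ` S))"
  shows integral_lebesgue_on_scaling:
    "(LINT x|lebesgue_on ((\<lambda>x. c *\<^sub>R x) ` S). f x) = c ^ DIM('a) *\<^sub>R (LINT x|lebesgue_on S. f (c *\<^sub>R x))" 
    and integrable_lebesgue_on_scaling:
    "integrable (lebesgue_on ((\<lambda>x. c *\<^sub>R x) ` S)) f \<longleftrightarrow> integrable (lebesgue_on S) (\<lambda>x. f (c *\<^sub>R x))" 
proof -
  let ?N = "lebesgue_on ((\<lambda>x. c *\<^sub>R x) ` S)"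
  let ?D = "distr (lebesgue_on S) ?N (\<lambda>x. c *\<^sub>R x)"
  note m = lebesgue_on_scaling(1)[OF c S]
  have fD: "f \<in> borel_measurable ?D" using f by simp
  have "(LINT x|?N. f x) = (LINT x|density ?D (\<lambda>_. ennreal (c ^ DIM('a))). f x)"
    using lebesgue_on_scaling(2)[OF c S] by simp
  also have "\<dots> = (LINT x|?D. c ^ DIM('a) *\<^sub>R f x)"
    using c by (intro integral_density fD) auto
  also have "\<dots> = c ^ DIM('a) *\<^sub>R (LINT x|lebesgue_on S. f (c *\<^sub>R x))"
    by (simp add: integral_distr[OF m f])
  finally show "(LINT x|?N. f x) = c ^ DIM('a) *\<^sub>R (LINT x|lebesgue_on S. f (c *\<^sub>R x))" .
  have "integrable ?N f \<longleftrightarrow> integrable (density ?D (\<lambda>_. ennreal (c ^ DIM('a)))) f"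
    using lebesgue_on_scaling(2)[OF c S] by simp
  also have "\<dots> \<longleftrightarrow> integrable ?D (\<lambda>x. c ^ DIM('a) *\<^sub>R f x)"
    using c by (intro integrable_density fD) auto
  also have "\<dots> \<longleftrightarrow> integrable (lebesgue_on S) (\<lambda>x. c ^ DIM('a) *\<^sub>R f (c *\<^sub>R x))"
    using f by (subst integrable_distr_eq[OF m]) auto
  also have "\<dots> \<longleftrightarrow> integrable (lebesgue_on S) (\<lambda>x. f (c *\<^sub>R x))"
  proof
    assume "integrable (lebesgue_on S) (\<lambda>x. c ^ DIM('a) *\<^sub>R f (c *\<^sub>R x))"
    note integrable_scaleR_right[OF this, of "inverse (c ^ DIM('a))"]
    moreover have "inverse (c ^ DIM('a)) *\<^sub>R c ^ DIM('a) *\<^sub>R y = y" for y :: 'b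
      using c by simp
    ultimately show "integrable (lebesgue_on S) (\<lambda>x. f (c *\<^sub>R x))" by (simp only:)
  qed (intro integrable_scaleR_right)
  finally show "integrable ?N f \<longleftrightarrow> integrable (lebesgue_on S) (\<lambda>x. f (c *\<^sub>R x))" .
qed

section \<open>The Fourier system on the square\<close>

lemma w_eq_cis:
  "w T j k r = of_real (1 / (2 * T)) * cis (of_int j * (pi / T) * fst r) * cis (of_int k * (pi / T) * snd r)"
  by (cases r) (simp add: w_def cis_conv_exp)

text \<open>
  Up to its normalisation, each \<open>w T j k\<close> is a character of the plane. This identity is what turns
  the shifts of the tomography operator into multiplication of Fourier coefficients.
\<close>

lemma w_add: "T \<noteq> 0 \<Longrightarrow> w T j k (r + s) = of_real (2 * T) * w T j k s * w T j k r"
  unfolding w_eq_cis fst_add snd_add distrib_left cis_mult[symmetric] by simp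

lemma w_mult: "w T j k r * w T j' k' r = of_real (1 / (2 * T)) * w T (j + j') (k + k') r"
  unfolding w_eq_cis of_int_add distrib_right cis_mult[symmetric] by (simp only: mult_ac)

lemma cnj_w: "cnj (w T j k r) = w T (- j) (- k) r"
  by (simp add: w_eq_cis cis_cnj)

lemma norm_w: "T > 0 \<Longrightarrow> norm (w T j k r) = 1 / (2 * T)"
  by (simp only: w_eq_cis norm_mult norm_cis norm_of_real) simp

lemma w_lattice_point: "T \<noteq> 0 \<Longrightarrow> w T j k (lattice_point T m) = of_real (1 / (2 * T))"
proof -
  assume "T \<noteq> 0"
  have *: "cis (of_int a * (pi / T) * (2 * T * of_int b)) = 1" for a b
  proof -
    have "of_int a * (pi / T) * (2 * T * of_int b) = 2 * pi * of_int (a * b)"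
      using \<open>T \<noteq> 0\<close> by simp
    then show ?thesis by (metis Ints_of_int cis_multiple_2pi)
  qed
  show ?thesis by (simp only: w_eq_cis lattice_point_def fst_conv snd_conv *) simp
qed

lemma w_wrap:
  assumes "T > 0" shows "w T j k (wrap T r) = w T j k r"
proof -
  have "w T j k (wrap T r + lattice_point T (cell T r)) = w T j k (wrap T r)"
    using assms by (simp add: w_add w_lattice_point)
  then show ?thesis by (simp add: wrap_def)
qed

lemma continuous_on_w: "continuous_on S (w T j k)"
proof -
  have "continuous_on S (\<lambda>r. c * cis (a * fst r) * cis (b * snd r))" for a b :: real and c
    by (intro continuous_intros)
  then show ?thesis unfolding w_eq_cis[abs_def] .
qed

lemma w_measurable: "w T j k \<in> borel_measurable (lebesgue_on (Omega T))"
  by (intro continuous_imp_measurable_on_sets_lebesgue continuous_on_w Omega_sets)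

lemma w_L2: "T > 0 \<Longrightarrow> w T j k \<in> L2 (Omega T)"
  by (rule L2_bounded[OF Omega_lmeasurable w_measurable, where B = "1 / (2 * T)"]) (simp add: norm_w)

lemma measure_Omega: "T > 0 \<Longrightarrow> measure lebesgue (Omega T) = 4 * T\<^sup>2"
  unfolding Omega_eq_cbox by (simp add: content_Pair power2_eq_square)

text \<open>
  A shift by \<open>s\<close> modulo the lattice multiplies the integral of a character by its value at \<open>s\<close>, yet leaves the
  integral unchanged. For a nontrivial character a shift by half its period in one
  variable gives the factor \<open>-1\<close>, so the integral vanishes.
\<close>

lemma integral_w:
  assumes T: "T > 0"
  shows "(LINT r|lebesgue_on (Omega T). w T j k r) = (if j = 0 \<and> k = 0 then of_real (2 * T) else 0)"
proof -
  let ?I = "LINT r|lebesgue_on (Omega T). w T j k r"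
  have shift: "?I = of_real (2 * T) * w T j k s * ?I" for s
  proof -
    have "?I = (LINT r|lebesgue_on (Omega T). w T j k (wrap T (r + s)))"
      by (rule integral_wrap_shift[OF T w_measurable, symmetric])
    also have "\<dots> = of_real (2 * T) * w T j k s * ?I"
      using T by (simp add: w_wrap w_add)
    finally show ?thesis .
  qed
  consider "j = 0 \<and> k = 0" | "j \<noteq> 0" | "k \<noteq> 0" by blast
  then show ?thesis
  proof cases
    case 1
    have "?I = (LINT r|lebesgue_on (Omega T). of_real (1 / (2 * T)))"
      using 1 by (intro Bochner_Integration.integral_cong) (auto simp: w_eq_cis)
    also have "\<dots> = of_real (2 * T)"
      using T Omega_sets[of T] by (simp add: measure_restrict_space measure_Omega power2_eq_square scaleR_conv_of_real)
    finally show ?thesis using 1 by simp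
  next
    case 2
    have "of_real (2 * T) * w T j k (T / of_int j, 0) = -1" using 2 T by (simp add: w_eq_cis)
    then have "?I = - ?I" using shift[of "(T / of_int j, 0)"] by simp
    then show ?thesis using 2 by simp
  next
    case 3
    have "of_real (2 * T) * w T j k (0, T / of_int k) = -1" using 3 T by (simp add: w_eq_cis)
    then have "?I = - ?I" using shift[of "(0, T / of_int k)"] by simp
    then show ?thesis using 3 by simp
  qed
qed

lemma L2_orthonormal_w:
  assumes T: "T > 0"
  shows "L2_orthonormal (Omega T) (\<lambda>(j, k). w T j k)"
proof
  fix i i' :: "int \<times> int"
  obtain j k j' k' where [simp]: "i = (j, k)" "i' = (j', k')" by (cases i, cases i')
  show "(case i of (j, k) \<Rightarrow> w T j k) \<in> L2 (Omega T)" by (simp add: w_L2[OF T])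
  have "L2_inner (Omega T) (w T j k) (w T j' k') = of_real (1 / (2 * T)) * (LINT r|lebesgue_on (Omega T). w T (j - j') (k - k') r)"
    unfolding L2_inner_def cnj_w w_mult by simp
  also have "\<dots> = (if i = i' then 1 else 0)" using T by (auto simp: integral_w[OF T])
  finally show "L2_inner (Omega T) (case i of (j, k) \<Rightarrow> w T j k) (case i' of (j, k) \<Rightarrow> w T j k) =
      (if i = i' then 1 else 0)" by simp
qed

section \<open>Completeness of the Fourier system\<close>

text \<open>
  This map identifies opposite sides of the square, and so realises the torus
  as a compact subset of a Euclidean space, where the Stone--Weierstrass theorem applies.
\<close>

definition torus_map :: "real \<Rightarrow> real \<times> real \<Rightarrow> complex \<times> complex" where
  "torus_map T r = (cis (pi / T * fst r), cis (pi / T * snd r))"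

lemma continuous_on_torus_map: "continuous_on S (torus_map T)"
proof -
  have "continuous_on S (\<lambda>r. (cis (a * fst r), cis (a * snd r)))" for a :: real
    by (intro continuous_intros)
  then show ?thesis unfolding torus_map_def[abs_def] .
qed

lemma cis_eq_imp_eq:
  assumes "cis (pi / T * a) = cis (pi / T * b)" "-T < a" "a < T" "-T \<le> b" "b \<le> T"
  shows "a = b"
proof -
  have T: "T > 0" using assms by linarith
  have "cis (pi / T * a - pi / T * b) = 1"
    using assms(1) by (simp add: cis_divide[symmetric])
  then have "cos (pi / T * a - pi / T * b) = 1" by (metis cis.sel(1) one_complex.sel(1))
  then obtain n :: int where "pi / T * a - pi / T * b = of_int n * (2 * pi)"
    by (auto simp: cos_one_2pi_int)
  then have "pi * (a - b) = pi * (of_int n * (2 * T))" using T by (simp add: field_simps)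
  then have n: "a - b = of_int n * (2 * T)" by simp
  have "\<bar>a - b\<bar> < 2 * T" using assms by linarith
  then have "\<bar>of_int n :: real\<bar> * (2 * T) < 1 * (2 * T)" using T by (simp add: n abs_mult)
  then have "\<bar>of_int n :: real\<bar> < 1" using T by (simp only: mult_less_cancel_right)
  then have "n = 0" by linarith
  then show ?thesis using n by simp
qed

lemma torus_map_inj:
  assumes "torus_map T r = torus_map T r'" "r \<in> box (-T, -T) (T, T)" "r' \<in> Omega T"
  shows "r = r'"
  using assms by (cases r, cases r')
    (auto simp: torus_map_def mem_box_square Omega_def intro: cis_eq_imp_eq)

inductive trig_polynomial :: "real \<Rightarrow> (real \<times> real \<Rightarrow> complex) \<Rightarrow> bool" for T where
  w: "trig_polynomial T (w T j k)"
| add: "trig_polynomial T f \<Longrightarrow> trig_polynomial T g \<Longrightarrow> trig_polynomial T (\<lambda>r. f r + g r)"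
| cmult: "trig_polynomial T f \<Longrightarrow> trig_polynomial T (\<lambda>r. c * f r)"

lemma trig_polynomial_mult:
  assumes "trig_polynomial T f" "trig_polynomial T g"
  shows "trig_polynomial T (\<lambda>r. f r * g r)"
proof -
  have *: "trig_polynomial T (\<lambda>r. w T j k r * g r)" for j k
    using assms(2)
  proof induction
    case (w j' k')
    show ?case unfolding w_mult by (intro trig_polynomial.intros)
  next
    case (add f g)
    then show ?case unfolding distrib_left by (intro trig_polynomial.add)
  next
    case (cmult f c)
    then show ?case unfolding mult.left_commute[of _ c] by (intro trig_polynomial.cmult)
  qed
  show ?thesis
    using assms(1)
  proof induction
    case (add f1 f2)
    then show ?case unfolding distrib_right by (intro trig_polynomial.add)
  next
    case (cmult f c)
    then show ?case unfolding mult.assoc by (intro trig_polynomial.cmult)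
  qed (rule *)
qed

lemma trig_polynomial_const:
  assumes "T > 0" shows "trig_polynomial T (\<lambda>r. c)"
proof -
  have "(\<lambda>r. c) = (\<lambda>r. (c * of_real (2 * T)) * w T 0 0 r)"
    using assms by (simp add: w_eq_cis)
  then show ?thesis by (metis trig_polynomial.cmult trig_polynomial.w)
qed

lemma trig_polynomial_cis_coordinates:
  assumes "T > 0"
  shows "trig_polynomial T (\<lambda>r. of_real (Re (fst (torus_map T r))))"
    and "trig_polynomial T (\<lambda>r. of_real (Im (fst (torus_map T r))))"
    and "trig_polynomial T (\<lambda>r. of_real (Re (snd (torus_map T r))))"
    and "trig_polynomial T (\<lambda>r. of_real (Im (snd (torus_map T r))))"
proof -
  have re: "complex_of_real (Re (cis a)) = T * (of_real (1 / (2 * T)) * cis a) + T * (of_real (1 / (2 * T)) * cis (- a))" 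
   and im: "complex_of_real (Im (cis a)) = (- \<i> * T) * (of_real (1 / (2 * T)) * cis a) + (\<i> * T) * (of_real (1 / (2 * T)) * cis (- a))" for a
    using assms by (simp_all add: complex_eq_iff)
  have p: "of_real (1 / (2 * T)) * cis (pi / T * fst r) = w T 1 0 r"
       "of_real (1 / (2 * T)) * cis (- (pi / T * fst r)) = w T (-1) 0 r"
       "of_real (1 / (2 * T)) * cis (pi / T * snd r) = w T 0 1 r"
       "of_real (1 / (2 * T)) * cis (- (pi / T * snd r)) = w T 0 (-1) r" for r
    by (simp_all add: w_eq_cis)
  show "trig_polynomial T (\<lambda>r. of_real (Re (fst (torus_map T r))))"
    and "trig_polynomial T (\<lambda>r. of_real (Im (fst (torus_map T r))))"
    and "trig_polynomial T (\<lambda>r. of_real (Re (snd (torus_map T r))))"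
    and "trig_polynomial T (\<lambda>r. of_real (Im (snd (torus_map T r))))"
    unfolding torus_map_def fst_conv snd_conv re im p
    by (intro trig_polynomial.intros)+
qed

text \<open>
  The four real coordinates of the torus are trigonometric polynomials of degree one, so every
  real polynomial in them is a trigonometric polynomial.
\<close>

lemma trig_polynomial_real_polynomial:
  assumes T: "T > 0" and "real_polynomial_function p"
  shows "trig_polynomial T (\<lambda>r. of_real (p (torus_map T r)))"
  using assms(2)
proof induction
  case (linear f)
  interpret f: bounded_linear f by fact
  have "f z = f (1, 0) * Re (fst z) + f (\<i>, 0) * Im (fst z) + f (0, 1) * Re (snd z) + f (0, \<i>) * Im (snd z)" for z
  proof -
    have "z = Re (fst z) *\<^sub>R (1, 0) + Im (fst z) *\<^sub>R (\<i>, 0) + Re (snd z) *\<^sub>R (0, 1) + Im (snd z) *\<^sub>R (0, \<i>)"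
      by (cases z) (simp add: complex_eq_iff)
    then have "f z = f (Re (fst z) *\<^sub>R (1, 0) + Im (fst z) *\<^sub>R (\<i>, 0) + Re (snd z) *\<^sub>R (0, 1) + Im (snd z) *\<^sub>R (0, \<i>))"
      by metis
    then show ?thesis by (simp only: f.add f.scaleR) simp
  qed
  note eq = this
  show ?case
    by (subst eq, unfold of_real_add of_real_mult)
       (intro trig_polynomial.add trig_polynomial.cmult trig_polynomial_cis_coordinates T)
qed (use T in \<open>auto intro: trig_polynomial_const trig_polynomial_mult trig_polynomial.add\<close>)

context
  fixes T :: real
  assumes T: "T > 0"
begin

interpretation fourier: L2_orthonormal "Omega T" "\<lambda>(j, k). w T j k"
  by (rule L2_orthonormal_w[OF T])

lemma expands_trig_polynomial:
  "trig_polynomial T p \<Longrightarrow> fourier.expands p"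
proof (induction rule: trig_polynomial.induct)
  case (w j k)
  then show ?case using fourier.expands_basis[of "(j, k)"] by simp
qed (auto intro: fourier.expands_add fourier.expands_cmult)

text \<open>
  By Stone--Weierstrass, a continuous function on the torus is a uniform limit of real polynomials in the
  coordinates; uniform approximation implies \<open>L2\<close> approximation because the square has finite measure.
\<close>

lemma expands_continuous_on_torus:
  fixes g :: "complex \<times> complex \<Rightarrow> real"
  assumes g: "continuous_on (torus_map T ` Omega T) g"
  shows "fourier.expands (\<lambda>r. of_real (g (torus_map T r)))"
proof (rule fourier.expands_approx)
  let ?K = "torus_map T ` Omega T"
  have K: "compact ?K"
    unfolding Omega_eq_cbox by (intro compact_continuous_image continuous_on_torus_map compact_cbox)
  have gc: "continuous_on (Omega T) (\<lambda>r. complex_of_real (g (torus_map T r)))"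
    using continuous_on_compose2[OF g continuous_on_torus_map] by (intro continuous_intros) auto
  have "compact (g ` ?K)" by (rule compact_continuous_image[OF g K])
  then obtain B where B: "\<forall>z\<in>?K. norm (g z) \<le> B"
    by (auto dest!: compact_imp_bounded simp: bounded_iff)
  show gL: "(\<lambda>r. complex_of_real (g (torus_map T r))) \<in> L2 (Omega T)"
    using B by (intro L2_bounded[OF Omega_lmeasurable, where B = B]
        continuous_imp_measurable_on_sets_lebesgue gc Omega_sets) auto
  fix \<epsilon> :: real assume \<epsilon>: "\<epsilon> > 0"
  \<comment> \<open>The square has measure \<open>4 * T\<^sup>2\<close>, so this \<open>\<delta>\<close> makes the squared \<open>L2\<close> error at most \<open>\<epsilon> / 4\<close>.\<close>
  define \<delta> where "\<delta> = sqrt \<epsilon> / (4 * T)"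
  have \<delta>: "\<delta> > 0" "\<delta>\<^sup>2 * (4 * T\<^sup>2) < \<epsilon>"
    using \<epsilon> T by (auto simp: \<delta>_def field_simps power2_eq_square)
  obtain p where p: "real_polynomial_function p" "\<And>z. z \<in> ?K \<Longrightarrow> \<bar>g z - p z\<bar> < \<delta>"
    using Stone_Weierstrass_real_polynomial_function[OF K g \<delta>(1)] by blast
  let ?p = "\<lambda>r. complex_of_real (p (torus_map T r))"
  have ep: "fourier.expands ?p"
    by (intro expands_trig_polynomial trig_polynomial_real_polynomial T p(1))
  interpret finite_measure "lebesgue_on (Omega T)"
    by (rule finite_measure_lebesgue_on[OF Omega_lmeasurable])
  have "(L2_norm (Omega T) (\<lambda>r. of_real (g (torus_map T r)) - ?p r))\<^sup>2 \<le> (LINT r|lebesgue_on (Omega T). \<delta>\<^sup>2)"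
    unfolding L2_norm_squared
  proof (rule integral_mono)
    show "integrable (lebesgue_on (Omega T)) (\<lambda>r. (norm (of_real (g (torus_map T r)) - ?p r))\<^sup>2)"
      by (rule L2_integrable[OF L2_diff[OF gL fourier.expands_L2[OF ep]]])
    fix r assume "r \<in> space (lebesgue_on (Omega T))"
    then have "\<bar>g (torus_map T r) - p (torus_map T r)\<bar> < \<delta>" using p(2) by simp
    then show "(norm (of_real (g (torus_map T r)) - ?p r))\<^sup>2 \<le> \<delta>\<^sup>2"
      by (intro power_mono) (simp_all flip: of_real_diff)
  qed simp
  also have "\<dots> < \<epsilon>"
    using \<delta>(2) T Omega_sets[of T] by (simp add: measure_restrict_space measure_Omega mult.commute)
  finally show "\<exists>p. fourier.expands p \<and> (L2_norm (Omega T) (\<lambda>r. of_real (g (torus_map T r)) - p r))\<^sup>2 < \<epsilon>"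
    using ep by blast
qed

text \<open>
  If \<open>C\<close> is the image of \<open>Omega T - U\<close> on the torus, the functions \<open>min 1 (n * infdist z C)\<close> are
  continuous on the torus and increase to the indicator of the complement of \<open>C\<close>. The map to the torus identifies no point of
  the open square with another point of the square, so composing with it gives the indicator of \<open>U\<close>.
\<close>

lemma expands_indicator_open:
  assumes U: "open U" "U \<subseteq> box (-T, -T) (T, T)"
  shows "fourier.expands (indicator U)"
proof -
  let ?C = "torus_map T ` (Omega T - U)"
  have C: "closed ?C" "?C \<noteq> {}"
  proof -
    have "compact (Omega T - U)"
      unfolding Omega_eq_cbox using U(1) by (simp add: compact_diff)
    then show "closed ?C"
      by (intro compact_imp_closed compact_continuous_image continuous_on_torus_map)
    have "(T, T) \<in> Omega T - U" using U(2) T by (auto simp: mem_box_square Omega_def)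
    then show "?C \<noteq> {}" by blast
  qed
  define f where "f n r = complex_of_real (min 1 (real n * infdist (torus_map T r) ?C))" for n r
  show ?thesis
  proof (rule fourier.expands_dominated_limit[where p = f and G = "\<lambda>_. 1"])
    interpret finite_measure "lebesgue_on (Omega T)"
      by (rule finite_measure_lebesgue_on[OF Omega_lmeasurable])
    show "integrable (lebesgue_on (Omega T)) (\<lambda>_. 1 :: real)" by simp
    have "(indicator U :: _ \<Rightarrow> complex) \<in> borel_measurable (lebesgue_on (Omega T))"
      using U(1) by (intro measurable_restrict_space1 borel_measurable_indicator) simp
    then show "(indicator U :: _ \<Rightarrow> complex) \<in> L2 (Omega T)"
      by (rule L2_bounded[OF Omega_lmeasurable, where B = 1]) (simp add: indicator_def)
    show "fourier.expands (f n)" for n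
      unfolding f_def by (rule expands_continuous_on_torus) (intro continuous_intros)
    fix r assume r: "r \<in> Omega T"
    show "(\<lambda>n. f n r) \<longlonglongrightarrow> indicator U r"
    proof (cases "r \<in> U")
      case True
      then have "torus_map T r \<notin> ?C" using torus_map_inj[of T r] U(2) by auto
      then have d: "infdist (torus_map T r) ?C > 0"
        using C by (simp add: infdist_pos_not_in_closed)
      have "\<forall>\<^sub>F n in sequentially. real n * infdist (torus_map T r) ?C \<ge> 1"
      proof -
        obtain N where "1 / infdist (torus_map T r) ?C < real N" using reals_Archimedean2 by blast
        then have "real n * infdist (torus_map T r) ?C \<ge> 1" if "n \<ge> N" for n
        proof -
          have "1 / infdist (torus_map T r) ?C \<le> real n" using that \<open>_ < real N\<close> by linarith
          then show ?thesis using d by (simp add: field_simps)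
        qed
        then show ?thesis unfolding eventually_sequentially by blast
      qed
      then have "\<forall>\<^sub>F n in sequentially. f n r = indicator U r"
        by eventually_elim (use True in \<open>simp add: f_def\<close>)
      then show ?thesis by (rule tendsto_eventually)
    next
      case False
      then have "torus_map T r \<in> ?C" using r by blast
      then show ?thesis using False by (simp add: f_def)
    qed
    show "(norm (indicator U r - f n r))\<^sup>2 \<le> 1" for n
    proof -
      have "indicator U r - f n r = of_real (indicator U r - min 1 (real n * infdist (torus_map T r) ?C))"
        by (simp add: f_def indicator_def)
      then have "norm (indicator U r - f n r) = \<bar>indicator U r - min 1 (real n * infdist (torus_map T r) ?C)\<bar>"
        by (metis norm_of_real)
      also have "\<dots> \<le> 1"
        using infdist_nonneg[of "torus_map T r" ?C] by (auto simp: indicator_def min_def)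
      finally show ?thesis by (simp add: power_le_one)
    qed
  qed
qed

text \<open>
  Outer regularity gives an open set containing \<open>A\<close> with small excess. Cutting it down to the open square
  changes it, within \<open>Omega T\<close>, only on the boundary, which is a null set.
\<close>

lemma expands_indicator:
  assumes A: "A \<in> sets lebesgue" "A \<subseteq> Omega T"
  shows "fourier.expands (indicator A)"
proof (rule fourier.expands_approx)
  have "(indicator A :: _ \<Rightarrow> complex) \<in> borel_measurable (lebesgue_on (Omega T))"
    using A(1) by (intro measurable_restrict_space1 borel_measurable_indicator)
  then show AL: "(indicator A :: _ \<Rightarrow> complex) \<in> L2 (Omega T)"
    by (rule L2_bounded[OF Omega_lmeasurable, where B = 1]) (simp add: indicator_def)
  fix \<epsilon> :: real assume "\<epsilon> > 0"
  from sets_lebesgue_outer_open[OF A(1) this] obtain U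
    where U: "open U" "A \<subseteq> U" "U - A \<in> lmeasurable" "emeasure lebesgue (U - A) < ennreal \<epsilon>" by blast
  let ?b = "box (-T, -T) (T, T)"
  let ?X = "(U - A) \<union> (Omega T - ?b)"
  have eU: "fourier.expands (indicator (U \<inter> ?b))"
    using U(1) by (intro expands_indicator_open) (auto intro: open_Int open_box)
  have b: "Omega T - ?b \<in> null_sets lebesgue"
    using negligible_convex_frontier[OF convex_box(1)[of "(-T, -T)" "(T, T)"]] 
    by (simp add: negligible_iff_null_sets Omega_eq_cbox frontier_cbox)
  have X: "?X \<in> lmeasurable" using U(3) b by (simp add: fmeasurable.Un fmeasurableI_null_sets)
  have "(L2_norm (Omega T) (\<lambda>r. indicator A r - indicator (U \<inter> ?b) r :: complex))\<^sup>2
        \<le> (LINT r|lebesgue_on (Omega T). indicator ?X r)"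
    unfolding L2_norm_squared
  proof (rule integral_mono)
    show "integrable (lebesgue_on (Omega T)) (\<lambda>r. (norm (indicator A r - indicator (U \<inter> ?b) r :: complex))\<^sup>2)"
      by (rule L2_integrable[OF L2_diff[OF AL fourier.expands_L2[OF eU]]])
    interpret finite_measure "lebesgue_on (Omega T)"
      by (rule finite_measure_lebesgue_on[OF Omega_lmeasurable])
    show "integrable (lebesgue_on (Omega T)) (indicator ?X :: _ \<Rightarrow> real)"
      using fmeasurableD[OF X]
      by (intro integrable_const_bound[where B = 1] AE_I2 measurable_restrict_space1 borel_measurable_indicator)
         (auto simp: indicator_def)
    show "(norm (indicator A r - indicator (U \<inter> ?b) r :: complex))\<^sup>2 \<le> indicator ?X r"
      if "r \<in> space (lebesgue_on (Omega T))" for r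
      using that U(2) by (auto simp: indicator_def)
  qed
  also have "\<dots> = measure lebesgue (?X \<inter> Omega T)"
    using Omega_sets by (simp add: measure_restrict_space Int_commute)
  also have "\<dots> \<le> measure lebesgue ?X"
    using X by (intro measure_mono_fmeasurable) (auto intro: Omega_sets)
  also have "\<dots> = measure lebesgue (U - A)"
    using U(3) b by (intro measure_Un_null_set) auto
  also have "\<dots> < \<epsilon>"
    using U(3,4) \<open>\<epsilon> > 0\<close> by (simp add: emeasure_eq_measure2 ennreal_less_iff)
  finally show "\<exists>p. fourier.expands p \<and> (L2_norm (Omega T) (\<lambda>r. indicator A r - p r))\<^sup>2 < \<epsilon>"
    using eU by blast
qed

lemma expands_simple_function:
  assumes s: "simple_function (lebesgue_on (Omega T)) s"
  shows "fourier.expands s"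
proof -
  let ?A = "\<lambda>y. s -` {y} \<inter> Omega T"
  have fin: "finite (s ` Omega T)" using simple_functionD(1)[OF s] by simp
  have "?A y \<in> sets (lebesgue_on (Omega T))" for y
    using simple_functionD(2)[OF s, of "{y}"] by simp
  then have "?A y \<in> sets lebesgue" for y
    using sets_restrict_space_iff[of "Omega T" lebesgue "?A y"] Omega_sets by auto
  then have "fourier.expands (\<lambda>r. \<Sum>y\<in>s ` Omega T. y * indicator (?A y) r)"
    by (intro fourier.expands_sum fourier.expands_cmult expands_indicator) auto
  then show ?thesis
  proof (rule fourier.expands_cong)
    fix r assume r: "r \<in> Omega T"
    have "(\<Sum>y\<in>s ` Omega T. y * indicator (?A y) r) = (\<Sum>y\<in>s ` Omega T. if y = s r then y else 0)"
      using r by (intro sum.cong) (auto simp: indicator_def)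
    then show "s r = (\<Sum>y\<in>s ` Omega T. y * indicator (?A y) r)"
      using fin r by simp
  qed
qed

theorem L2_has_sum_fourier:
  assumes f: "f \<in> L2 (Omega T)"
  shows "L2_has_sum (Omega T) (\<lambda>(j, k) r. L2_inner (Omega T) f (w T j k) * w T j k r) f UNIV"
proof -
  let ?M = "lebesgue_on (Omega T)"
  obtain s where s: "\<And>n. simple_function ?M (s n)"
    "\<forall>r\<in>Omega T. (\<lambda>n. s n r) \<longlonglongrightarrow> f r"
    "\<forall>n. \<forall>r\<in>Omega T. norm (s n r) \<le> 2 * norm (f r)"
    using borel_measurable_implies_sequence_metric[OF L2_measurable[OF f], of 0] by auto
  have "fourier.expands f"
  proof (rule fourier.expands_dominated_limit[OF f, where p = s and G = "\<lambda>r. 9 * (norm (f r))\<^sup>2"])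
    show "integrable ?M (\<lambda>r. 9 * (norm (f r))\<^sup>2)" using L2_integrable[OF f] by simp
    show "(norm (f r - s n r))\<^sup>2 \<le> 9 * (norm (f r))\<^sup>2" if "r \<in> Omega T" for n r
    proof -
      have "norm (f r - s n r) \<le> norm (f r) + norm (s n r)" by (rule norm_triangle_ineq4)
      also have "\<dots> \<le> 3 * norm (f r)" using s(3) that by fastforce
      finally have "(norm (f r - s n r))\<^sup>2 \<le> (3 * norm (f r))\<^sup>2" by (intro power_mono) auto
      then show ?thesis by (simp add: power_mult_distrib)
    qed
  qed (use s expands_simple_function in auto)
  then show ?thesis unfolding fourier.expands_def by (simp add: case_prod_unfold)
qed

end

section \<open>The tomography operator\<close>

text \<open>
  The shift modulo the period lattice is an isometry of \<open>L2 (Omega T)\<close> and maps \<open>w T j k\<close> to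
  a scalar multiple of itself. It may therefore be applied to the Fourier series term by term.
\<close>

lemma L2_has_sum_fourier_shift:
  assumes T: "T > 0" and f: "f \<in> L2 (Omega T)"
  shows "L2_has_sum (Omega T)
     (\<lambda>(j, k) r. of_real (2 * T) * w T j k s * L2_inner (Omega T) f (w T j k) * w T j k r)
     (\<lambda>r. f (wrap T (r + s))) UNIV"
  unfolding L2_has_sum_def
proof (intro conjI ballI)
  let ?c = "\<lambda>i. L2_inner (Omega T) f (w T (fst i) (snd i))" and ?w = "\<lambda>i. w T (fst i) (snd i)"
  note F = L2_has_sum_fourier[OF T f, unfolded L2_has_sum_def case_prod_unfold]
  have "(\<lambda>r. f (wrap T (r + s)) - (\<Sum>i\<in>F. of_real (2 * T) * ?w i s * ?c i * ?w i r)) =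
        (\<lambda>r. (\<lambda>r. f r - (\<Sum>i\<in>F. ?c i * ?w i r)) (wrap T (r + s)))" for F
    using T by (simp only: w_wrap w_add[OF less_imp_neq[symmetric]] mult_ac)
  then have "L2_norm (Omega T) (\<lambda>r. f (wrap T (r + s)) - (\<Sum>i\<in>F. of_real (2 * T) * ?w i s * ?c i * ?w i r)) =
        L2_norm (Omega T) (\<lambda>r. f r - (\<Sum>i\<in>F. ?c i * ?w i r))" for F
    using L2_wrap_shift(2)[OF T L2_diff[OF f L2_sum[OF L2_cmult[OF w_L2[OF T]]]]] by simp
  then show "((\<lambda>F. L2_norm (Omega T) (\<lambda>r. f (wrap T (r + s)) -
      (\<Sum>i\<in>F. (case i of (j, k) \<Rightarrow> \<lambda>r. of_real (2 * T) * w T j k s * L2_inner (Omega T) f (w T j k) * w T j k r) r)))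
        \<longlongrightarrow> 0) (finite_subsets_at_top UNIV)"
    using F by (simp add: case_prod_unfold)
qed (use T f in \<open>auto intro: L2_wrap_shift(1) L2_cmult w_L2\<close>)

text \<open>
  Scaling by \<open>c\<close> takes the period lattice of \<open>Omega T\<close> to that of \<open>Omega (c * T)\<close>. A layer of
  relative size \<open>c\<close> is thus a rescaled copy of the unscaled square with the shift divided by \<open>c\<close>.
\<close>

lemma wrap_scaling:
  assumes "c > 0"
  shows "wrap (c * T) (c *\<^sub>R r + a) = c *\<^sub>R wrap T (r + a /\<^sub>R c)"
proof -
  have "(c * x + y + c * T) / (2 * (c * T)) = (x + inverse c * y + T) / (2 * T)" for x y
  proof -
    have "c * (inverse c * y) = y" using assms by (simp flip: mult.assoc)
    then have "(c * x + y + c * T) / (2 * (c * T)) = (c * (x + inverse c * y + T)) / (c * (2 * T))"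
      by (simp only: distrib_left mult.left_commute[of 2 c])
    also have "\<dots> = (x + inverse c * y + T) / (2 * T)" using assms by simp
    finally show ?thesis .
  qed
  then have "cell (c * T) (c *\<^sub>R r + a) = cell T (r + a /\<^sub>R c)"
    by (simp add: cell_def)
  moreover have "lattice_point (c * T) k = c *\<^sub>R lattice_point T k" for k
    by (simp add: lattice_point_def)
  ultimately show ?thesis using assms
    by (simp add: wrap_def scaleR_diff_right scaleR_add_right)
qed

text \<open>
  The change of variables contributes the Jacobian \<open>c\<^sup>2\<close>, of which the normalisation \<open>1 / c\<close> of the
  layer basis leaves one factor \<open>c\<close>; it cancels against the \<open>1 / c\<close> in the matrix entry.
\<close>

lemma L2_layer:
  assumes c: "c > 0" and f: "f \<in> L2 ((\<lambda>r. c *\<^sub>R r) ` Omega T)" 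
  shows "(\<lambda>r. f (c *\<^sub>R r)) \<in> L2 (Omega T)"
    and "L2_inner ((\<lambda>r. c *\<^sub>R r) ` Omega T) f (\<lambda>r. of_real (inverse c) * w T j k (r /\<^sub>R c)) =
         of_real c * L2_inner (Omega T) (\<lambda>r. f (c *\<^sub>R r)) (w T j k)"
proof -
  let ?S = "(\<lambda>r. c *\<^sub>R r) ` Omega T"
  have fm: "f \<in> borel_measurable (lebesgue_on ?S)" by (rule L2_measurable[OF f])
  show "(\<lambda>r. f (c *\<^sub>R r)) \<in> L2 (Omega T)"
    unfolding L2_def
  proof (safe)
    show "(\<lambda>r. f (c *\<^sub>R r)) \<in> borel_measurable (lebesgue_on (Omega T))"
      by (rule measurable_compose[OF lebesgue_on_scaling(1)[OF c Omega_sets] fm])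
    show "integrable (lebesgue_on (Omega T)) (\<lambda>r. (norm (f (c *\<^sub>R r)))\<^sup>2)"
      using L2_integrable[OF f] fm
      by (subst integrable_lebesgue_on_scaling[OF c Omega_sets, of "\<lambda>r. (norm (f r))\<^sup>2", symmetric]) auto
  qed
  let ?h = "\<lambda>r. f r * cnj (of_real (inverse c) * w T j k (r /\<^sub>R c))"
  have "continuous_on ?S (\<lambda>r. cnj (of_real (inverse c) * w T j k (r /\<^sub>R c)))"
    by (intro continuous_intros continuous_on_compose2[OF continuous_on_w[of UNIV]]) auto
  then have "(\<lambda>r. cnj (of_real (inverse c) * w T j k (r /\<^sub>R c))) \<in> borel_measurable (lebesgue_on ?S)"
    by (intro continuous_imp_measurable_on_sets_lebesgue lebesgue_on_scaling(3)[OF c Omega_sets])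
  then have hm: "?h \<in> borel_measurable (lebesgue_on ?S)"
    using fm by measurable
  have "L2_inner ?S f (\<lambda>r. of_real (inverse c) * w T j k (r /\<^sub>R c)) =
      c\<^sup>2 *\<^sub>R (LINT r|lebesgue_on (Omega T). of_real (inverse c) * (f (c *\<^sub>R r) * cnj (w T j k r)))"
    unfolding L2_inner_def integral_lebesgue_on_scaling[OF c Omega_sets hm]
    using c by (simp add: mult_ac power2_eq_square)
  also have "\<dots> = of_real c * L2_inner (Omega T) (\<lambda>r. f (c *\<^sub>R r)) (w T j k)"
  proof -
    have "c\<^sup>2 *\<^sub>R (of_real (inverse c) * z) = of_real c * z" for z :: complex
      using c by (simp add: scaleR_conv_of_real power2_eq_square)
    then show ?thesis by (simp only: L2_inner_def integral_mult_right_zero)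
  qed
  finally show "L2_inner ?S f (\<lambda>r. of_real (inverse c) * w T j k (r /\<^sub>R c)) =
         of_real c * L2_inner (Omega T) (\<lambda>r. f (c *\<^sub>R r)) (w T j k)" .
qed

lemma L2_has_sum_layer_trace:
  assumes T: "T > 0" and c: "c > 0" and f: "f \<in> L2 ((\<lambda>r. c *\<^sub>R r) ` Omega T)" 
  shows "L2_has_sum (Omega T)
     (\<lambda>(j, k) r. of_real (2 * T) * (of_real (inverse c) * w T j k (a /\<^sub>R c)) *
        L2_inner ((\<lambda>r. c *\<^sub>R r) ` Omega T) f (\<lambda>r. of_real (inverse c) * w T j k (r /\<^sub>R c)) * w T j k r)
     (\<lambda>r. periodic_ext (c * T) f (c *\<^sub>R r + a)) UNIV"
proof -
  have eq: "of_real (2 * T) * (of_real (inverse c) * u) * (of_real c * v) * z = of_real (2 * T) * u * v * z"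
    for u v z :: complex
    using c by simp
  show ?thesis
    using L2_has_sum_fourier_shift[OF T L2_layer(1)[OF c f], of "a /\<^sub>R c"]
    unfolding L2_layer(2)[OF c f] periodic_ext_eq wrap_scaling[OF c] eq .
qed

theorem proposition4p1:
  fixes \<Omega>\<^sub>A :: "(real \<times> real) set"
    and \<alpha> :: "'g::finite \<Rightarrow> real \<times> real"
    and h :: "'l::{finite, linorder} \<Rightarrow> real"
    and hLGS T :: real
    and \<phi> :: "'l \<Rightarrow> real \<times> real \<Rightarrow> complex"
  assumes "\<And>l. 0 \<le> h l"
    and "strict_mono h"
    and "\<And>l. h l < hLGS"
    and "T > 0"
    and "\<And>g l. (\<lambda>r. r + h l *\<^sub>R \<alpha> g) ` \<Omega>\<^sub>A \<subseteq> layer_dom h hLGS T l"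
    and "\<And>l. \<phi> l \<in> L2 (layer_dom h hLGS T l)"
  shows "L2_has_sum (Omega T)
           (\<lambda>(j, k) r. w T j k r *s (tomography_matrix \<alpha> h hLGS T j k *v layer_coeffs h hLGS T \<phi> j k))
           (tomography \<alpha> h hLGS T \<phi>)
           (UNIV :: (int \<times> int) set)"
proof (rule L2_has_sum_vecI)
  fix g :: 'g
  let ?c = "cone h hLGS"
  let ?t = "\<lambda>l (j, k) r. of_real (2 * T) * (of_real (inverse (?c l)) * w T j k ((h l *\<^sub>R \<alpha> g) /\<^sub>R ?c l)) *
        L2_inner (layer_dom h hLGS T l) (\<phi> l) (w_layer h hLGS T j k l) * w T j k r"
  have c: "?c l > 0" for l
    using assms(1,3)[of l] by (simp add: cone_def)
  have "L2_has_sum (Omega T) (?t l) (\<lambda>r. periodic_ext (?c l * T) (\<phi> l) (?c l *\<^sub>R r + h l *\<^sub>R \<alpha> g)) UNIV" for l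
    using L2_has_sum_layer_trace[OF \<open>T > 0\<close> c assms(6)[of l, unfolded layer_dom_def]]
    unfolding w_layer_def layer_dom_def .
  then have "L2_has_sum (Omega T) (\<lambda>i r. \<Sum>l\<in>UNIV. ?t l i r) (\<lambda>r. tomography \<alpha> h hLGS T \<phi> r $ g) UNIV"
    unfolding tomography_def by (simp add: L2_has_sum_sum)
  moreover have "(\<lambda>i r. \<Sum>l\<in>UNIV. ?t l i r) = (\<lambda>i r. (case i of (j, k) \<Rightarrow>
      \<lambda>r. w T j k r *s (tomography_matrix \<alpha> h hLGS T j k *v layer_coeffs h hLGS T \<phi> j k)) r $ g)"
  proof (intro ext)
    fix i :: "int \<times> int" and r
    obtain j k where i: "i = (j, k)" by (cases i)
    have pair: "(fst (\<alpha> g) * h l, snd (\<alpha> g) * h l) = h l *\<^sub>R \<alpha> g" for l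
      by (simp add: prod_eq_iff)
    show "(\<Sum>l\<in>UNIV. ?t l i r) = (case i of (j, k) \<Rightarrow>
      \<lambda>r. w T j k r *s (tomography_matrix \<alpha> h hLGS T j k *v layer_coeffs h hLGS T \<phi> j k)) r $ g"
      by (simp only: i prod.case tomography_matrix_def layer_coeffs_def matrix_vector_mult_def
          w_layer_def pair vec_lambda_beta vector_smult_component sum_distrib_left mult_ac pair[unfolded mult.commute[of _ "h _"]])
  qed
  ultimately show "L2_has_sum (Omega T) (\<lambda>i r. (case i of (j, k) \<Rightarrow>
      \<lambda>r. w T j k r *s (tomography_matrix \<alpha> h hLGS T j k *v layer_coeffs h hLGS T \<phi> j k)) r $ g)
      (\<lambda>r. tomography \<alpha> h hLGS T \<phi> r $ g) UNIV" by simp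
qed

end
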